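(* Let $S:U\rightrightarrows\mathbb R^q$ be a Lipschitz continuous set-valued function, where $U\subseteq\mathbb R^d$ is a convex compact set and $S(u)$ is a convex compact set for each $u\in U$. Let $X_1,X_2,\ldots$ be i.i.d. random vectors in $U$ with a Lipschitz continuous density function $f_X$ that satisfies $f_X(u)>0$ for $u\in U$, and let $S_i=S(X_i)\oplus W_i$, where $W_1,W_2,\ldots$ are i.i.d. random vectors with zero mean $\mathbb E(W)=0$ and finite variance $\|\mathbb E(WW^{\mathsf T})\|<+\infty$. Let $\varphi$ be a kernel function, $\varphi_h(u)=h^{-d}\varphi(\|u\|/h)$, and define $$\widehat S(u)=\Big[\tfrac1n\bigoplus_{i=1}^n\varphi_h(X_i-u)\cdot S_i\Big]\cdot\Big[\tfrac1n\sum_{i=1}^n\varphi_h(X_i-u)\Big]^{-1}.$$ If $h=n^{-1/(d+4)}$, then $\operatorname{as-lim}_n\widehat S(u)=S(u)$ for $u\in U$.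
   Context: A kernel function is a function $\varphi:\mathbb R\to\mathbb R$ that is non-negative, bounded, even, and has finite support in the sense that there is a constant $\eta\in(0,1)$ such that $\varphi(u)>0$ when $|u|\le\eta$ and $\varphi(u)=0$ when $|u|\ge1$. $C\oplus D=\{c+d:c\in C,d\in D\}$ is the Minkowski sum (a vector is identified with a singleton) and scalar multiples of sets are elementwise. A set-valued function $S$ is Lipschitz continuous on $U$ with constant $\kappa\in\mathbb R_+$ if it is nonempty- and closed-valued and $S(x')\subseteq S(x)+\kappa\|x'-x\|\mathbb B$ for $x,x'\in U$, where $\mathbb B$ is the closed unit ball. Set limits: $\limsup_n C_n=\{x:\exists n_k\text{ s.t. }x_{n_k}\to x\text{ with }x_{n_k}\in C_{n_k}\}$, $\liminf_n C_n=\{x:\exists x_n\to x\text{ with }x_n\in C_n\}$; $\lim_n C_n$ exists when these are equal, in which case it is their common value. $\operatorname{as-lim}_nC_n=C$ means $\mathbb P(\lim_nC_n=C)=1$ on the underlying complete probability space.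
   Formalization: The sequence of the X_i is assumed independent of the sequence of the W_i (without this W_i = X_i − E X_i is a counterexample), and the kernel function is assumed Lebesgue measurable so that the weights are random variables. *)

theory Defs
  imports "HOL-Probability.Probability"
begin

definition kernel_function :: "(real \<Rightarrow> real) \<Rightarrow> bool" where
  "kernel_function \<phi> \<longleftrightarrow>
     (\<forall>t. 0 \<le> \<phi> t) \<and> bounded (range \<phi>) \<and> (\<forall>t. \<phi> (- t) = \<phi> t) \<and>
     (\<exists>\<eta>. 0 < \<eta> \<and> \<eta> < 1 \<and>
        (\<forall>t. \<bar>t\<bar> \<le> \<eta> \<longrightarrow> 0 < \<phi> t) \<and> (\<forall>t. 1 \<le> \<bar>t\<bar> \<longrightarrow> \<phi> t = 0))"

definition scaled_kernel :: "(real \<Rightarrow> real) \<Rightarrow> real \<Rightarrow> real ^ 'd \<Rightarrow> real" where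
  "scaled_kernel \<phi> h v = \<phi> (norm v / h) / h ^ CARD('d)"

text \<open>Addition and finite sums of sets below are the Minkowski operations of the
  set algebra library; in particular the empty sum is the singleton of the origin.\<close>

definition lipschitz_setfun ::
  "real \<Rightarrow> 'a::real_normed_vector set \<Rightarrow> ('a \<Rightarrow> 'b::real_normed_vector set) \<Rightarrow> bool" where
  "lipschitz_setfun \<kappa> U S \<longleftrightarrow>
     0 \<le> \<kappa> \<and> (\<forall>x\<in>U. S x \<noteq> {} \<and> closed (S x)) \<and>
     (\<forall>x\<in>U. \<forall>x'\<in>U. S x' \<subseteq> S x + (*\<^sub>R) (\<kappa> * norm (x' - x)) ` cball 0 1)"

definition set_limsup :: "(nat \<Rightarrow> 'a::topological_space set) \<Rightarrow> 'a set" where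
  "set_limsup C =
     {x. \<exists>r y. strict_mono (r :: nat \<Rightarrow> nat) \<and> (\<forall>k. y k \<in> C (r k)) \<and> y \<longlonglongrightarrow> x}"

definition set_liminf :: "(nat \<Rightarrow> 'a::topological_space set) \<Rightarrow> 'a set" where
  "set_liminf C = {x. \<exists>y. (\<forall>n. y n \<in> C n) \<and> y \<longlonglongrightarrow> x}"

definition has_set_limit :: "(nat \<Rightarrow> 'a::topological_space set) \<Rightarrow> 'a set \<Rightarrow> bool" where
  "has_set_limit C L \<longleftrightarrow> set_limsup C = L \<and> set_liminf C = L"

text \<open>The measure of a non-measurable set is 0 by convention, so probability 1 below
  includes measurability of the event.\<close>

definition as_set_limit ::
  "'w measure \<Rightarrow> (nat \<Rightarrow> 'w \<Rightarrow> 'a::topological_space set) \<Rightarrow> 'a set \<Rightarrow> bool" where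
  "as_set_limit M C L \<longleftrightarrow> \<P>(\<omega> in M. has_set_limit (\<lambda>n. C n \<omega>) L) = 1"

text \<open>Samples are indexed from 0, so a sample of size n has indices below n.
  If all kernel weights vanish, the value is \<open>{0}\<close>, since the inverse of 0 is 0.\<close>

definition kernel_set_estimator ::
  "(real \<Rightarrow> real) \<Rightarrow> real \<Rightarrow> nat \<Rightarrow> (nat \<Rightarrow> real ^ 'd) \<Rightarrow> (nat \<Rightarrow> (real ^ 'q) set) \<Rightarrow>
     real ^ 'd \<Rightarrow> (real ^ 'q) set" where
  "kernel_set_estimator \<phi> h n x T u =
     (*\<^sub>R) (inverse (1 / real n * (\<Sum>i<n. scaled_kernel \<phi> h (x i - u)))) `
       ((*\<^sub>R) (1 / real n) ` (\<Sum>i<n. (*\<^sub>R) (scaled_kernel \<phi> h (x i - u)) ` T i))"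

text \<open>The library's \<open>indep_var\<close> requires both random variables to take values in the
  same type; the following is its characterization \<open>indep_var_eq\<close> with two value types.\<close>

definition indep_rvs ::
  "'w measure \<Rightarrow> 'a measure \<Rightarrow> ('w \<Rightarrow> 'a) \<Rightarrow> 'b measure \<Rightarrow> ('w \<Rightarrow> 'b) \<Rightarrow> bool" where
  "indep_rvs M A Y B Z \<longleftrightarrow>
     Y \<in> measurable M A \<and> Z \<in> measurable M B \<and>
     prob_space.indep_set M
       (sigma_sets (space M) {Y -` E \<inter> space M | E. E \<in> sets A})
       (sigma_sets (space M) {Z -` E \<inter> space M | E. E \<in> sets B})"

end

theory Submission
  imports Defs "HOL-Real_Asymp.Real_Asymp"
begin

text \<open>Normalised by \<open>D = \<Sum>\<^sub>i \<phi> (\<parallel>X\<^sub>i - u\<parallel> / h)\<close>, the estimator is a convex combination of the sets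
  \<open>S (X\<^sub>i)\<close> with \<open>X\<^sub>i\<close> in the ball of radius \<open>h\<close> around \<open>u\<close>, shifted by the weighted average of the
  noise. Since \<open>S\<close> is Lipschitz and \<open>S u\<close> is convex, its Hausdorff distance to \<open>S u\<close> is at most
  \<open>\<kappa> h\<close> plus the norm of that average, so it suffices that the average tends to 0 almost surely.

  A second moment alone gives no summable Chebyshev bound for all \<open>n\<close>, and the kernel is not monotone,
  so one cannot pass to a subsequence directly. Instead, fix the sample \<open>X\<close> (it is independent of
  \<open>W\<close>) and truncate the noise at a constant level \<open>T\<close>. For the bounded part Hoeffding's inequality
  gives probabilities \<open>exp (- const \<cdot> D)\<close> with \<open>D \<ge> const \<cdot> n powr (4 / (d + 4))\<close>, which are summable over
  all \<open>n\<close>. The tail is bounded, for \<open>n\<close> in \<open>[2\<^sup>j, 2\<^sup>j\<^sup>+\<^sup>1)\<close>, by the tail sum over all sample points in the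
  largest ball of the block, and there Chebyshev's inequality is geometrically small. The required
  two-sided control of the number of sample points near \<open>u\<close> comes from Chernoff bounds.\<close>

subsection \<open>Weighted averages with deterministic weights\<close>

lemma summable_exp_powr:
  fixes c g :: real
  assumes "0 < c" "0 < g"
  shows "summable (\<lambda>n. exp (- (c * real n powr g)))"
proof (rule summable_comparison_test_bigo)
  show "summable (\<lambda>n. norm (real n powr (- 2)))"
    by (simp add: summable_real_powr_iff)
  show "(\<lambda>n. exp (- (c * real n powr g))) \<in> O(\<lambda>n. real n powr (- 2))"
    using assms by real_asymp
qed

text \<open>Only countably many tolerances occur on the right, so \<open>AE\<close> can be moved
  through the quantifier, and below the convergence event becomes measurable.\<close>

lemma tendsto_zero_iff_inverse_Suc:
  fixes x :: "nat \<Rightarrow> 'b::real_normed_vector"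
  shows "x \<longlonglongrightarrow> 0 \<longleftrightarrow> (\<forall>m. \<exists>N. \<forall>n\<ge>N. norm (x n) \<le> inverse (real (Suc m)))"
proof
  assume x: "x \<longlonglongrightarrow> 0"
  show "\<forall>m. \<exists>N. \<forall>n\<ge>N. norm (x n) \<le> inverse (real (Suc m))"
  proof
    fix m
    have "\<forall>\<^sub>F n in sequentially. norm (x n) < inverse (real (Suc m))"
      using tendstoD[OF x, of "inverse (real (Suc m))"] by simp
    then show "\<exists>N. \<forall>n\<ge>N. norm (x n) \<le> inverse (real (Suc m))"
      unfolding eventually_sequentially by (meson less_imp_le)
  qed
next
  assume x: "\<forall>m. \<exists>N. \<forall>n\<ge>N. norm (x n) \<le> inverse (real (Suc m))"
  show "x \<longlonglongrightarrow> 0"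
  proof (rule tendstoI)
    fix e :: real assume "0 < e"
    then obtain m where m: "inverse (real (Suc m)) < e"
      using reals_Archimedean by blast
    with x show "\<forall>\<^sub>F n in sequentially. dist (x n) 0 < e"
      unfolding eventually_sequentially by (metis dist_0_norm dist_commute le_less_trans)
  qed
qed

lemma AE_tendsto_zeroI:
  fixes F :: "nat \<Rightarrow> 'a \<Rightarrow> 'b::real_normed_vector"
  assumes "\<And>e. 0 < e \<Longrightarrow> AE x in M. \<forall>\<^sub>F n in sequentially. norm (F n x) \<le> e"
  shows "AE x in M. (\<lambda>n. F n x) \<longlonglongrightarrow> 0"
  unfolding tendsto_zero_iff_inverse_Suc eventually_sequentially[symmetric]
  by (subst AE_all_countable) (auto intro!: assms)

text \<open>Each term ranges over an interval of width \<open>2 * k i * T\<close>, so Hoeffding's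
  exponent has \<open>4 * T\<^sup>2 * (\<Sum>i<n. (k i)\<^sup>2)\<close> in its denominator.
  Bounding one factor of every square by \<open>B\<close> makes the exponent linear in the total
  weight.\<close>

lemma (in prob_space) weighted_Hoeffding_bound:
  fixes Z :: "nat \<Rightarrow> 'a \<Rightarrow> real" and k :: "nat \<Rightarrow> real"
  assumes ind: "indep_vars (\<lambda>_. borel) Z UNIV"
    and Z: "\<And>i \<omega>. \<bar>Z i \<omega>\<bar> \<le> T" "\<And>i. expectation (Z i) = 0"
    and k: "\<And>i. 0 \<le> k i" "\<And>i. k i \<le> B"
    and pos: "0 < T" "0 < B" "0 < e" "0 < (\<Sum>i<n. k i)"
  shows "prob {\<omega> \<in> space M. e * (\<Sum>i<n. k i) \<le> \<bar>\<Sum>i<n. k i * Z i \<omega>\<bar>}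
    \<le> 2 * exp (- (e\<^sup>2 / (2 * T\<^sup>2 * B) * (\<Sum>i<n. k i)))"
proof -
  define D where "D = (\<Sum>i<n. k i)"
  define V where "V = (\<Sum>i<n. (k i * T - - (k i * T))\<^sup>2)"
  interpret Hoeffding_ineq M "{..<n}" "\<lambda>i \<omega>. k i * Z i \<omega>" "\<lambda>i. - (k i * T)" "\<lambda>i. k i * T" 0
  proof unfold_locales
    show "indep_vars (\<lambda>_. borel) (\<lambda>i \<omega>. k i * Z i \<omega>) {..<n}"
      by (rule indep_vars_compose2[OF indep_vars_subset[OF ind]]) auto
    show "AE x in M. k i * Z i x \<in> {- (k i * T)..k i * T}" for i
    proof (intro AE_I2)
      fix x
      have "\<bar>k i * Z i x\<bar> \<le> k i * T"
        using k(1)[of i] Z(1)[of i x] by (simp add: abs_mult mult_left_mono)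
      then show "k i * Z i x \<in> {- (k i * T)..k i * T}" by (auto simp: abs_le_iff)
    qed
    show "0 \<equiv> \<Sum>i<n. expectation (\<lambda>\<omega>. k i * Z i \<omega>)"
      by (simp add: Z(2))
  qed auto
  have V_eq: "V = 4 * T\<^sup>2 * (\<Sum>i<n. (k i)\<^sup>2)"
    unfolding V_def by (simp add: sum_distrib_left power_mult_distrib algebra_simps)
  \<comment> \<open>Hoeffding's inequality divides by the total squared width \<open>V\<close>; one
    positive weight is enough for \<open>0 < V\<close>.\<close>
  obtain i where i: "i < n" "0 < k i"
    using pos(4) k(1) by (metis lessThan_iff not_less sum_nonpos)
  have "0 < (\<Sum>i<n. (k i)\<^sup>2)"
    by (rule sum_pos2[of _ i]) (use i in auto)
  then have V_pos: "0 < V" using V_eq pos by simp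
  have "(\<Sum>i<n. (k i)\<^sup>2) \<le> (\<Sum>i<n. B * k i)"
    by (intro sum_mono) (use k in \<open>auto simp: power2_eq_square intro!: mult_right_mono\<close>)
  then have V_le: "V \<le> 4 * T\<^sup>2 * (B * D)"
    unfolding V_eq D_def by (intro mult_left_mono) (auto simp: sum_distrib_left)
  have D: "0 < D" using pos by (simp add: D_def)
  have "e\<^sup>2 / (2 * T\<^sup>2 * B) * D = 2 * (e * D)\<^sup>2 / (4 * T\<^sup>2 * (B * D))"
    using D pos by (simp add: field_simps power2_eq_square)
  also have "\<dots> \<le> 2 * (e * D)\<^sup>2 / V"
    using V_le V_pos by (intro divide_left_mono) (use D pos in auto)
  finally have *: "e\<^sup>2 / (2 * T\<^sup>2 * B) * D \<le> 2 * (e * D)\<^sup>2 / V" .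
  have "prob {\<omega> \<in> space M. e * D \<le> \<bar>(\<Sum>i<n. k i * Z i \<omega>) - 0\<bar>} \<le> 2 * exp (- 2 * (e * D)\<^sup>2 / V)"
    unfolding V_def by (rule Hoeffding_ineq_abs_ge) (use D pos V_pos in \<open>auto simp: V_def\<close>)
  also have "\<dots> \<le> 2 * exp (- (e\<^sup>2 / (2 * T\<^sup>2 * B) * D))"
    using * by simp
  finally show ?thesis by (simp add: D_def)
qed

text \<open>First Borel-Cantelli lemma for predicates; an eventual bound suffices because finitely
  many terms do not affect summability.\<close>

lemma (in prob_space) AE_eventually_not:
  assumes [measurable]: "\<And>n. Measurable.pred M (P n)"
    and "\<forall>\<^sub>F n in sequentially. prob {\<omega> \<in> space M. P n \<omega>} \<le> g n" "summable g"
  shows "AE \<omega> in M. \<forall>\<^sub>F n in sequentially. \<not> P n \<omega>"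
proof -
  have "summable (\<lambda>n. prob {\<omega> \<in> space M. P n \<omega>})"
    using assms(2) by (intro summable_comparison_test_ev[OF _ assms(3)]) (auto elim!: eventually_mono)
  then have "AE \<omega> in M. \<forall>\<^sub>F n in sequentially. \<omega> \<in> space M - {\<omega> \<in> space M. P n \<omega>}"
    by (intro borel_cantelli_AE1) (auto simp: emeasure_eq_measure)
  then show ?thesis by eventually_elim (auto elim: eventually_mono)
qed

text \<open>As the total weight is at least \<open>c * real n powr g\<close>, the Hoeffding bound is
  a stretched exponential in \<open>n\<close> and is summable over all \<open>n\<close>, without
  passing to a subsequence.\<close>

lemma (in prob_space) bounded_weighted_average_AE:
  fixes Z :: "nat \<Rightarrow> 'a \<Rightarrow> real" and k :: "nat \<Rightarrow> nat \<Rightarrow> real"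
  assumes ind: "indep_vars (\<lambda>_. borel) Z UNIV"
    and Z: "\<And>i \<omega>. \<bar>Z i \<omega>\<bar> \<le> T" "\<And>i. expectation (Z i) = 0"
    and k: "\<And>n i. 0 \<le> k n i" "\<And>n i. k n i \<le> B"
    and pos: "0 < T" "0 < B" "0 < e" "0 < c" "0 < g"
    and D: "\<forall>\<^sub>F n in sequentially. c * real n powr g \<le> (\<Sum>i<n. k n i)"
  shows "AE \<omega> in M. \<forall>\<^sub>F n in sequentially. \<bar>\<Sum>i<n. k n i * Z i \<omega>\<bar> < e * (\<Sum>i<n. k n i)"
proof -
  define c' where "c' = e\<^sup>2 / (2 * T\<^sup>2 * B)"
  have c': "0 < c'" using pos by (simp add: c'_def)
  have [measurable]: "random_variable borel (Z i)" for i
    using ind by (auto simp: indep_vars_def)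
  have "AE \<omega> in M. \<forall>\<^sub>F n in sequentially. \<not> (e * (\<Sum>i<n. k n i) \<le> \<bar>\<Sum>i<n. k n i * Z i \<omega>\<bar>)"
  proof (rule AE_eventually_not[where g = "\<lambda>n. 2 * exp (- (c' * c * real n powr g))"])
    show "\<forall>\<^sub>F n in sequentially. prob {\<omega> \<in> space M. e * (\<Sum>i<n. k n i) \<le> \<bar>\<Sum>i<n. k n i * Z i \<omega>\<bar>}
      \<le> 2 * exp (- (c' * c * real n powr g))"
      using D eventually_gt_at_top[of 0]
    proof eventually_elim
      case (elim n)
      have "0 < c * real n powr g" using elim pos by simp
      with elim have pos': "0 < (\<Sum>i<n. k n i)" by linarith
      have "prob {\<omega> \<in> space M. e * (\<Sum>i<n. k n i) \<le> \<bar>\<Sum>i<n. k n i * Z i \<omega>\<bar>}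
        \<le> 2 * exp (- (c' * (\<Sum>i<n. k n i)))"
        unfolding c'_def by (rule weighted_Hoeffding_bound[OF ind Z k]) (use pos pos' in auto)
      also have "\<dots> \<le> 2 * exp (- (c' * (c * real n powr g)))"
        using elim c' by (auto intro!: mult_left_mono)
      finally show ?case by (simp add: mult.assoc)
    qed
    show "summable (\<lambda>n. 2 * exp (- (c' * c * real n powr g)))"
      by (intro summable_mult summable_exp_powr) (use c' pos in auto)
  qed measurable
  then show ?thesis by (simp add: not_le)
qed

text \<open>After expanding the square, independence factors each off-diagonal expectation into a
  product of two zero means, so only the diagonal survives.\<close>

lemma (in prob_space) second_moment_centered_sum:
  fixes Y :: "nat \<Rightarrow> 'a \<Rightarrow> real" and s :: real
  assumes ind: "indep_vars (\<lambda>_. borel) Y UNIV" and "finite J"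
    and Y: "\<And>i. integrable M (Y i)" "\<And>i. integrable M (\<lambda>\<omega>. (Y i \<omega>)\<^sup>2)"
      "\<And>i. expectation (Y i) = 0" "\<And>i. expectation (\<lambda>\<omega>. (Y i \<omega>)\<^sup>2) \<le> s"
  shows "integrable M (\<lambda>\<omega>. (\<Sum>i\<in>J. Y i \<omega>)\<^sup>2)" (is ?int)
    and "expectation (\<lambda>\<omega>. (\<Sum>i\<in>J. Y i \<omega>)\<^sup>2) \<le> card J * s" (is ?le)
proof -
  have prod: "integrable M (\<lambda>\<omega>. Y i \<omega> * Y j \<omega>)
      \<and> expectation (\<lambda>\<omega>. Y i \<omega> * Y j \<omega>) = (if i = j then expectation (\<lambda>\<omega>. (Y i \<omega>)\<^sup>2) else 0)" for i j
  proof (cases "i = j")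
    case True
    then show ?thesis using Y(2)[of i] by (simp add: power2_eq_square)
  next
    case False
    have "indep_vars (\<lambda>_. borel) Y {i, j}"
      by (rule indep_vars_subset[OF ind]) auto
    with False show ?thesis
      using indep_vars_lebesgue_integral[of "{i, j}" Y] indep_vars_integrable[of "{i, j}" Y] Y by auto
  qed
  have sq: "(\<Sum>i\<in>J. Y i \<omega>)\<^sup>2 = (\<Sum>i\<in>J. \<Sum>j\<in>J. Y i \<omega> * Y j \<omega>)" for \<omega>
    by (simp add: power2_eq_square sum_product)
  show ?int unfolding sq by (intro Bochner_Integration.integrable_sum) (use prod in auto)
  have "expectation (\<lambda>\<omega>. (\<Sum>i\<in>J. Y i \<omega>)\<^sup>2) = (\<Sum>i\<in>J. \<Sum>j\<in>J. expectation (\<lambda>\<omega>. Y i \<omega> * Y j \<omega>))"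
    unfolding sq by (subst Bochner_Integration.integral_sum, use prod in auto)+
  also have "\<dots> = (\<Sum>i\<in>J. expectation (\<lambda>\<omega>. (Y i \<omega>)\<^sup>2))"
    using prod \<open>finite J\<close> by (simp add: sum.delta)
  also have "\<dots> \<le> card J * s" using sum_bounded_above[of J "\<lambda>i. expectation (\<lambda>\<omega>. (Y i \<omega>)\<^sup>2)" s] Y(4) by simp
  finally show ?le .
qed

text \<open>The means contribute at most \<open>e * b j\<close>, so reaching
  \<open>2 * e * b j\<close> forces the centred sum to deviate by \<open>e * b j\<close>. Its
  variance is at most \<open>b j * s\<close>, and Chebyshev's inequality gives
  \<open>s / e\<^sup>2 * (1 / b j)\<close>, which is summable.\<close>

lemma (in prob_space) block_sum_AE:
  fixes G :: "nat \<Rightarrow> 'a \<Rightarrow> real" and J :: "nat \<Rightarrow> nat set"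
  assumes ind: "indep_vars (\<lambda>_. borel) G UNIV"
    and G: "\<And>i. integrable M (\<lambda>\<omega>. (G i \<omega>)\<^sup>2)" "\<And>i. expectation (G i) \<le> e"
      "\<And>i. expectation (\<lambda>\<omega>. (G i \<omega>)\<^sup>2) \<le> s"
    and J: "\<And>j. finite (J j)" "\<forall>\<^sub>F j in sequentially. real (card (J j)) \<le> b j"
    and b: "\<And>j. 0 < b j" "summable (\<lambda>j. 1 / b j)" and e: "0 < e"
  shows "AE \<omega> in M. \<forall>\<^sub>F j in sequentially. (\<Sum>i\<in>J j. G i \<omega>) < 2 * e * b j"
proof -
  define Y where "Y i \<omega> = G i \<omega> - expectation (G i)" for i \<omega>
  have [measurable]: "random_variable borel (G i)" for i
    using ind by (auto simp: indep_vars_def)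
  have G_int: "integrable M (G i)" for i
    using square_integrable_imp_integrable[OF _ G(1)] by simp
  have s: "0 \<le> s"
    by (rule order_trans[OF _ G(3)[of 0]]) simp
  have ind_Y: "indep_vars (\<lambda>_. borel) Y UNIV"
    unfolding Y_def[abs_def] by (rule indep_vars_compose2[OF ind]) auto
  have Y_int: "integrable M (Y i)" for i
    unfolding Y_def[abs_def] using G_int by simp
  have Y_sq: "(Y i \<omega>)\<^sup>2 = (G i \<omega>)\<^sup>2 - 2 * expectation (G i) * G i \<omega> + (expectation (G i))\<^sup>2" for i \<omega>
    by (simp add: Y_def power2_eq_square algebra_simps)
  have Y_sq_int: "integrable M (\<lambda>\<omega>. (Y i \<omega>)\<^sup>2)" for i
    unfolding Y_sq using G_int G(1) by simp
  have Y_exp: "expectation (Y i) = 0" for i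
    using G_int by (simp add: Y_def[abs_def] prob_space)
  have "expectation (\<lambda>\<omega>. (Y i \<omega>)\<^sup>2) \<le> s" for i
    using variance_eq[OF G_int G(1), of i] G(3)[of i]
    unfolding Y_def by (smt (verit) zero_le_power2)
  note Y2 = second_moment_centered_sum[OF ind_Y J(1) Y_int Y_sq_int Y_exp this]
  have [measurable]: "random_variable borel (Y i)" for i
    using Y_int by auto
  have Y_sum: "(\<Sum>i\<in>J j. G i \<omega>) = (\<Sum>i\<in>J j. Y i \<omega>) + (\<Sum>i\<in>J j. expectation (G i))" for j \<omega>
    by (simp add: Y_def sum_subtractf)
  have "AE \<omega> in M. \<forall>\<^sub>F j in sequentially. \<not> (2 * e * b j \<le> (\<Sum>i\<in>J j. G i \<omega>))"
  proof (rule AE_eventually_not[where g = "\<lambda>j. s / e\<^sup>2 * (1 / b j)"])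
    show "\<forall>\<^sub>F j in sequentially. prob {\<omega> \<in> space M. 2 * e * b j \<le> (\<Sum>i\<in>J j. G i \<omega>)}
      \<le> s / e\<^sup>2 * (1 / b j)"
      using J(2)
    proof eventually_elim
      case (elim j)
      have "(\<Sum>i\<in>J j. expectation (G i)) \<le> card (J j) * e"
        using sum_bounded_above[of "J j" "\<lambda>i. expectation (G i)" e] G(2) by simp
      also have "\<dots> \<le> e * b j" using elim e by simp
      finally have mean: "(\<Sum>i\<in>J j. expectation (G i)) \<le> e * b j" .
      have Ysum0: "expectation (\<lambda>\<omega>. \<Sum>i\<in>J j. Y i \<omega>) = 0"
        by (subst Bochner_Integration.integral_sum) (auto simp: Y_exp Y_int)
      have "prob {\<omega> \<in> space M. 2 * e * b j \<le> (\<Sum>i\<in>J j. G i \<omega>)}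
        \<le> prob {\<omega> \<in> space M. e * b j \<le> \<bar>(\<Sum>i\<in>J j. Y i \<omega>) - expectation (\<lambda>\<omega>. \<Sum>i\<in>J j. Y i \<omega>)\<bar>}"
        unfolding Ysum0 using mean by (intro finite_measure_mono) (auto simp: Y_sum)
      also have "\<dots> \<le> variance (\<lambda>\<omega>. \<Sum>i\<in>J j. Y i \<omega>) / (e * b j)\<^sup>2"
        by (rule Chebyshev_inequality) (use Y2(1) e b(1) in auto)
      also have "\<dots> \<le> (b j * s) / (e * b j)\<^sup>2"
        unfolding Ysum0 using Y2(2)[of j] elim s
        by (intro divide_right_mono) (auto intro: order_trans mult_right_mono)
      also have "\<dots> = s / e\<^sup>2 * (1 / b j)"
        using b(1)[of j] e by (simp add: power2_eq_square field_simps)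
      finally show ?case .
    qed
    show "summable (\<lambda>j. s / e\<^sup>2 * (1 / b j))"
      by (intro summable_mult b)
  qed measurable
  then show ?thesis by (simp add: not_le)
qed

section \<open>Truncation of the noise into a bounded part and a tail\<close>

lemma (in prob_space) exists_small_tail:
  fixes Z :: "'a \<Rightarrow> real"
  assumes "integrable M Z" "0 < e"
  shows "\<exists>T>0. expectation (\<lambda>\<omega>. if T < \<bar>Z \<omega>\<bar> then \<bar>Z \<omega>\<bar> else 0) \<le> e"
proof -
  have [measurable]: "random_variable borel Z" using assms by auto
  have "(\<lambda>m. expectation (\<lambda>\<omega>. if real m < \<bar>Z \<omega>\<bar> then \<bar>Z \<omega>\<bar> else 0)) \<longlonglongrightarrow> expectation (\<lambda>\<omega>. 0)"
  proof (rule integral_dominated_convergence[where w = "\<lambda>\<omega>. \<bar>Z \<omega>\<bar>"])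
    show "AE x in M. (\<lambda>m. if real m < \<bar>Z x\<bar> then \<bar>Z x\<bar> else 0) \<longlonglongrightarrow> 0"
    proof (intro AE_I2 tendsto_eventually)
      fix x
      obtain m0 :: nat where "\<bar>Z x\<bar> \<le> real m0" using real_arch_simple by blast
      then show "\<forall>\<^sub>F m in sequentially. (if real m < \<bar>Z x\<bar> then \<bar>Z x\<bar> else 0) = 0"
        by (intro eventually_mono[OF eventually_ge_at_top[of m0]]) auto
    qed
  qed (use assms in auto)
  then have "\<forall>\<^sub>F m in sequentially. expectation (\<lambda>\<omega>. if real m < \<bar>Z \<omega>\<bar> then \<bar>Z \<omega>\<bar> else 0) < e"
    using assms(2) by (auto intro: order_tendstoD)
  with eventually_gt_at_top[of 0] have "\<forall>\<^sub>F m in sequentially. 0 < m \<and> expectation (\<lambda>\<omega>. if real m < \<bar>Z \<omega>\<bar> then \<bar>Z \<omega>\<bar> else 0) < e"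
    by eventually_elim auto
  then obtain m :: nat where "0 < m" "expectation (\<lambda>\<omega>. if real m < \<bar>Z \<omega>\<bar> then \<bar>Z \<omega>\<bar> else 0) < e"
    by (auto simp: eventually_sequentially)
  then show ?thesis by (intro exI[of _ "real m"]) auto
qed

text \<open>The set \<open>J j\<close> collects every index that carries weight at some
  \<open>n\<close> of the \<open>j\<close>-th dyadic block, while its size stays comparable to the
  total weight. Hence one tail sum over \<open>J j\<close> controls the tails for the whole block,
  and only one event per block has to be excluded.\<close>

theorem (in prob_space) weighted_average_AE:
  fixes Z :: "nat \<Rightarrow> 'a \<Rightarrow> real" and k :: "nat \<Rightarrow> nat \<Rightarrow> real" and J :: "nat \<Rightarrow> nat set"
  assumes ind: "indep_vars (\<lambda>_. borel) Z UNIV"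
    and distr: "\<And>i. distr M borel (Z i) = distr M borel (Z 0)"
    and Z: "expectation (Z 0) = 0" "integrable M (\<lambda>\<omega>. (Z 0 \<omega>)\<^sup>2)"
    and k: "\<And>n i. 0 \<le> k n i" "\<And>n i. k n i \<le> B"
    and pos: "0 < c" "0 < C" "0 < g"
    and D: "\<forall>\<^sub>F n in sequentially. c * real n powr g \<le> (\<Sum>i<n. k n i)"
    and J: "\<And>j. finite (J j)" "\<forall>\<^sub>F j in sequentially. real (card (J j)) \<le> C * (2 ^ j) powr g"
      "\<And>n j i. 2 ^ j \<le> n \<Longrightarrow> n < 2 ^ Suc j \<Longrightarrow> i < n \<Longrightarrow> k n i \<noteq> 0 \<Longrightarrow> i \<in> J j"
  shows "AE \<omega> in M. (\<lambda>n. (\<Sum>i<n. k n i * Z i \<omega>) / (\<Sum>i<n. k n i)) \<longlonglongrightarrow> 0"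
proof (rule AE_tendsto_zeroI)
  fix e' :: real assume e': "0 < e'"
  have [measurable]: "random_variable borel (Z i)" for i
    using ind by (auto simp: indep_vars_def)
  \<comment> \<open>All \<open>Z i\<close> have the law of \<open>Z 0\<close>, so one truncation
    level and one truncated mean serve every index.\<close>
  have transport: "expectation (\<lambda>\<omega>. h (Z i \<omega>)) = expectation (\<lambda>\<omega>. h (Z 0 \<omega>))"
    if [measurable]: "h \<in> borel_measurable borel" for h :: "real \<Rightarrow> real" and i
    using distr[of i] integral_distr[of "Z i" M borel h] integral_distr[of "Z 0" M borel h] by simp
  have transport_int: "integrable M (\<lambda>\<omega>. h (Z i \<omega>)) \<longleftrightarrow> integrable M (\<lambda>\<omega>. h (Z 0 \<omega>))"
    if [measurable]: "h \<in> borel_measurable borel" for h :: "real \<Rightarrow> real" and i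
    using distr[of i] integrable_distr_eq[of "Z i" M borel h] integrable_distr_eq[of "Z 0" M borel h] by simp
  have Z_int: "integrable M (Z i)" for i
    using square_integrable_imp_integrable[OF _ Z(2)] transport_int[of "\<lambda>x. x" i] by simp
  \<comment> \<open>The Hoeffding step divides by the weight bound, and \<open>B\<close> may be 0;
    \<open>B + 1\<close> is strictly positive.\<close>
  define B' where "B' = B + 1"
  have B': "0 < B'" "\<And>n i. k n i \<le> B'"
    using order_trans[OF k(1) k(2)] by (auto simp: B'_def add_increasing2 k(2))
  \<comment> \<open>The final estimate has three contributions: \<open>e\<close> from the centred
    truncated part, \<open>e\<close> from the truncated mean, and
    \<open>e * (2 * B' * C / c)\<close> from the tail. This choice makes them add up to
    \<open>e'\<close>.\<close>
  define e where "e = e' / (2 + 2 * B' * C / c)"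
  have "0 < 2 + 2 * B' * C / c" using pos B'(1) by (simp add: add_pos_pos)
  then have e: "0 < e" "e * (2 + 2 * B' * C / c) = e'"
    using e' by (auto simp: e_def)
  obtain T where T: "0 < T" "expectation (\<lambda>\<omega>. if T < \<bar>Z 0 \<omega>\<bar> then \<bar>Z 0 \<omega>\<bar> else 0) \<le> e"
    using exists_small_tail[OF Z_int e(1)] by blast
  define t where "t x = (if T < \<bar>x\<bar> then 0 else x)" for x :: real
  have [measurable]: "t \<in> borel_measurable borel" unfolding t_def[abs_def] by measurable
  define tl where "tl x = (if T < \<bar>x\<bar> then \<bar>x\<bar> else 0)" for x :: real
  have [measurable]: "tl \<in> borel_measurable borel" unfolding tl_def[abs_def] by measurable
  define \<mu> where "\<mu> = expectation (\<lambda>\<omega>. t (Z 0 \<omega>))"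
  have t_bd: "\<bar>t x\<bar> \<le> T" for x using T by (auto simp: t_def)
  have t_int: "integrable M (\<lambda>\<omega>. t (Z i \<omega>))" for i
    by (rule integrable_const_bound[where B = T]) (use t_bd in auto)
  have tl_int: "integrable M (\<lambda>\<omega>. tl (Z i \<omega>))" for i
    by (rule Bochner_Integration.integrable_bound[OF Z_int[of i]]) (auto simp: tl_def)
  have t_diff: "\<bar>x - t x\<bar> = tl x" for x by (auto simp: t_def tl_def)
  \<comment> \<open>Because \<open>Z 0\<close> has mean zero, the mean of the truncated part is the
    negative of the mean of what was cut off, and is therefore as small as the tail.\<close>
  have "- \<mu> = expectation (\<lambda>\<omega>. Z 0 \<omega> - t (Z 0 \<omega>))"
    using Z(1) Z_int t_int by (simp add: \<mu>_def)
  then have "\<bar>\<mu>\<bar> \<le> expectation (\<lambda>\<omega>. \<bar>Z 0 \<omega> - t (Z 0 \<omega>)\<bar>)"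
    using integral_abs_bound[of M "\<lambda>\<omega>. Z 0 \<omega> - t (Z 0 \<omega>)"] by (metis abs_minus_cancel)
  also have "\<dots> \<le> e" using T(2) by (simp add: t_diff) (simp add: tl_def)
  finally have \<mu>: "\<bar>\<mu>\<bar> \<le> e" .
  have \<mu>_T: "\<bar>\<mu>\<bar> \<le> T"
    unfolding \<mu>_def
    by (rule order_trans[OF integral_abs_bound integral_le_const]) (use t_int[of 0] t_bd in auto)
  have bounded: "AE \<omega> in M. \<forall>\<^sub>F n in sequentially.
      \<bar>\<Sum>i<n. k n i * (t (Z i \<omega>) - \<mu>)\<bar> < e * (\<Sum>i<n. k n i)"
  proof (rule bounded_weighted_average_AE[where T = "2 * T" and B = B' and c = c and g = g])
    show "indep_vars (\<lambda>_. borel) (\<lambda>i \<omega>. t (Z i \<omega>) - \<mu>) UNIV"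
      by (rule indep_vars_compose2[OF ind]) auto
    show "\<bar>t (Z i \<omega>) - \<mu>\<bar> \<le> 2 * T" for i \<omega>
      using t_bd[of "Z i \<omega>"] \<mu>_T by linarith
    show "expectation (\<lambda>\<omega>. t (Z i \<omega>) - \<mu>) = 0" for i
      using t_int transport[of t i] by (simp add: \<mu>_def prob_space)
  qed (use k B' T e pos D in auto)
  have tail: "AE \<omega> in M. \<forall>\<^sub>F j in sequentially.
      (\<Sum>i\<in>J j. tl (Z i \<omega>)) < 2 * e * (C * (2 ^ j) powr g)"
  proof (rule block_sum_AE[where s = "expectation (\<lambda>\<omega>. (tl (Z 0 \<omega>))\<^sup>2)"])
    show "indep_vars (\<lambda>_. borel) (\<lambda>i \<omega>. tl (Z i \<omega>)) UNIV"
      by (rule indep_vars_compose2[OF ind]) auto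
    have "integrable M (\<lambda>\<omega>. (tl (Z 0 \<omega>))\<^sup>2)"
      by (rule Bochner_Integration.integrable_bound[OF Z(2)]) (auto simp: tl_def)
    then show "integrable M (\<lambda>\<omega>. (tl (Z i \<omega>))\<^sup>2)" for i
      using transport_int[of "\<lambda>x. (tl x)\<^sup>2" i] by simp
    show "expectation (\<lambda>\<omega>. tl (Z i \<omega>)) \<le> e" for i
      using transport[of tl i] T(2) by (simp add: tl_def)
    show "expectation (\<lambda>\<omega>. (tl (Z i \<omega>))\<^sup>2) \<le> expectation (\<lambda>\<omega>. (tl (Z 0 \<omega>))\<^sup>2)" for i
      using transport[of "\<lambda>x. (tl x)\<^sup>2" i] by simp
    have "(\<lambda>j. 1 / (C * (2 ^ j) powr g)) = (\<lambda>j. 1 / C * ((1 / 2 powr g) ^ j))"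
      by (auto simp: powr_realpow[symmetric] powr_powr mult.commute power_one_over divide_simps)
    moreover have "1 < 2 powr g" using pos by simp
    ultimately show "summable (\<lambda>j. 1 / (C * (2 ^ j) powr g))"
      by (auto intro!: summable_mult summable_geometric)
  qed (use J e pos in auto)
  show "AE \<omega> in M. \<forall>\<^sub>F n in sequentially. norm ((\<Sum>i<n. k n i * Z i \<omega>) / (\<Sum>i<n. k n i)) \<le> e'"
    using bounded tail
  proof eventually_elim
    case (elim \<omega>)
    obtain j0 where j0: "\<And>j. j0 \<le> j \<Longrightarrow> (\<Sum>i\<in>J j. tl (Z i \<omega>)) < 2 * e * (C * (2 ^ j) powr g)"
      using elim(2) by (auto simp: eventually_sequentially)
    show ?case
      using elim(1) D eventually_ge_at_top[of "2 ^ j0"]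
    proof eventually_elim
      case (elim n)
      define Dn where "Dn = (\<Sum>i<n. k n i)"
      have n: "0 < n" using elim(3) by (metis less_le_trans zero_less_numeral zero_less_power)
      \<comment> \<open>\<open>j\<close> is the dyadic block of \<open>n\<close>; from
        \<open>2 ^ j0 \<le> n < 2 ^ Suc j\<close> it follows that the block lies beyond the
        threshold of the tail estimate.\<close>
      obtain j where j: "2 ^ j \<le> n" "n < 2 ^ Suc j"
        using ex_power_ivl1[of 2 n] n by (auto)
      have "(2::nat) ^ j0 < 2 ^ Suc j" using elim(3) j by linarith
      then have "j0 \<le> j" using power_less_imp_less_exp[of "2::nat" j0 "Suc j"] by simp
      from j0[OF this] have tl_sum: "(\<Sum>i\<in>J j. tl (Z i \<omega>)) < 2 * e * (C * (2 ^ j) powr g)" .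
      have "(2 ^ j) powr g \<le> real n powr g"
        using j(1) pos by (intro powr_mono2) (auto simp: of_nat_le_iff[symmetric] simp del: of_nat_le_iff)
      also have "\<dots> \<le> Dn / c" using elim(2) pos by (simp add: Dn_def field_simps)
      finally have Dn: "(2 ^ j) powr g \<le> Dn / c" .
      have "0 < c * real n powr g" using n pos by simp
      then have Dn_pos: "0 < Dn" using elim(2) by (simp add: Dn_def)
      \<comment> \<open>Indices with nonzero weight lie in \<open>J j\<close>, and enlarging the sum
        to all of \<open>J j\<close> only increases it because \<open>tl\<close> is
        nonnegative.\<close>
      have "(\<Sum>i<n. k n i * tl (Z i \<omega>)) = (\<Sum>i\<in>{i. i < n \<and> k n i \<noteq> 0}. k n i * tl (Z i \<omega>))"
        by (rule sum.mono_neutral_right) auto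
      also have "\<dots> \<le> (\<Sum>i\<in>J j. B' * tl (Z i \<omega>))"
      proof (rule order_trans[OF sum_mono sum_mono2])
        show "{i. i < n \<and> k n i \<noteq> 0} \<subseteq> J j" using J(3)[OF j] by auto
      qed (use B' J(1) in \<open>auto simp: tl_def intro!: mult_right_mono\<close>)
      also have "\<dots> = B' * (\<Sum>i\<in>J j. tl (Z i \<omega>))" by (simp add: sum_distrib_left)
      also have "\<dots> \<le> B' * (2 * e * (C * (Dn / c)))"
      proof (intro mult_left_mono order_trans[OF less_imp_le[OF tl_sum]])
      qed (use B' Dn e pos in auto)
      finally have part2: "(\<Sum>i<n. k n i * tl (Z i \<omega>)) \<le> e * (2 * B' * C / c) * Dn"
        by (simp add: field_simps)
      have "(\<Sum>i<n. k n i * Z i \<omega>)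
        = (\<Sum>i<n. k n i * (t (Z i \<omega>) - \<mu>)) + \<mu> * Dn + (\<Sum>i<n. k n i * (Z i \<omega> - t (Z i \<omega>)))"
        by (simp add: Dn_def sum_distrib_left sum.distrib[symmetric] algebra_simps)
      moreover have "\<bar>\<Sum>i<n. k n i * (Z i \<omega> - t (Z i \<omega>))\<bar> \<le> (\<Sum>i<n. k n i * tl (Z i \<omega>))"
        by (rule order_trans[OF sum_abs]) (use k in \<open>simp add: abs_mult t_diff\<close>)
      moreover have "\<bar>\<mu> * Dn\<bar> \<le> e * Dn"
        using \<mu> Dn_pos by (simp add: abs_mult mult_right_mono)
      ultimately have "\<bar>\<Sum>i<n. k n i * Z i \<omega>\<bar> \<le> e * Dn + e * Dn + e * (2 * B' * C / c) * Dn"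
        using elim(1) part2 unfolding Dn_def[symmetric] by linarith
      also have "\<dots> = e' * Dn" unfolding e(2)[symmetric] by (simp add: algebra_simps)
      finally show ?case using Dn_pos by (simp add: Dn_def[symmetric] field_simps)
    qed
  qed
qed

subsection \<open>Set limits and the Hausdorff bound for the estimator\<close>

text \<open>The first distance bound forces subsequential limits into the closure of
  \<open>L\<close>, which is \<open>L\<close>; the second supplies approximating sequences for the
  points of \<open>L\<close>. The lower limit is always contained in the upper one.\<close>

lemma has_set_limitI:
  fixes C :: "nat \<Rightarrow> 'a::metric_space set"
  assumes "closed L" "\<And>n. C n \<noteq> {}" "e \<longlonglongrightarrow> 0"
    and sub1: "\<forall>\<^sub>F n in sequentially. \<forall>y\<in>C n. \<exists>x\<in>L. dist y x \<le> e n"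
    and sub2: "\<forall>\<^sub>F n in sequentially. \<forall>x\<in>L. \<exists>y\<in>C n. dist y x \<le> e n"
  shows "has_set_limit C L"
proof -
  have "set_limsup C \<subseteq> L"
  proof
    fix x assume "x \<in> set_limsup C"
    then obtain r y where r: "strict_mono r" and y: "\<And>k. y k \<in> C (r k)" "y \<longlonglongrightarrow> x"
      by (auto simp: set_limsup_def)
    have "x \<in> closure L"
    proof (unfold closure_approachable, intro allI impI)
      fix d :: real assume d: "0 < d"
      have 1: "\<forall>\<^sub>F k in sequentially. dist (y k) x < d / 2"
        using y(2) d by (intro tendstoD) auto
      have "\<forall>\<^sub>F n in sequentially. e n < d / 2"
        using assms(3) d by (intro order_tendstoD) auto
      with sub1 have "\<forall>\<^sub>F n in sequentially. \<forall>y\<in>C n. \<exists>x\<in>L. dist y x < d / 2"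
        by eventually_elim (meson le_less_trans)
      from eventually_subseq[OF r this] 1
      have "\<forall>\<^sub>F k in sequentially. \<exists>z\<in>L. dist z x < d"
      proof eventually_elim
        case (elim k)
        then obtain z where "z \<in> L" "dist (y k) z < d / 2" using y(1) by blast
        then show ?case using elim(2) dist_triangle3[of z x "y k"] by (intro bexI[of _ z]) auto
      qed
      then show "\<exists>z\<in>L. dist z x < d" by (auto simp: eventually_sequentially)
    qed
    then show "x \<in> L" using \<open>closed L\<close> by simp
  qed
  moreover have "L \<subseteq> set_liminf C"
  proof
    fix x assume x: "x \<in> L"
    \<comment> \<open>A lower-limit sequence must choose from \<open>C n\<close> for every
      \<open>n\<close>. Where no point within \<open>e n\<close> exists, which happens only finitely
      often, an arbitrary point is taken.\<close>
    define y where "y n = (if \<exists>y\<in>C n. dist y x \<le> e n then SOME y. y \<in> C n \<and> dist y x \<le> e n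
      else SOME y. y \<in> C n)" for n
    have y: "y n \<in> C n \<and> ((\<exists>y\<in>C n. dist y x \<le> e n) \<longrightarrow> dist (y n) x \<le> e n)" for n
    proof (cases "\<exists>y\<in>C n. dist y x \<le> e n")
      case True
      then have "\<exists>y. y \<in> C n \<and> dist y x \<le> e n" by blast
      from someI_ex[OF this] True show ?thesis by (simp add: y_def)
    next
      case False
      have "\<exists>y. y \<in> C n" using assms(2)[of n] by blast
      from someI_ex[OF this] False show ?thesis by (simp add: y_def)
    qed
    have "(\<lambda>n. dist (y n) x) \<longlonglongrightarrow> 0"
    proof (rule tendsto_sandwich[OF _ _ tendsto_const assms(3)])
      show "\<forall>\<^sub>F n in sequentially. dist (y n) x \<le> e n"
        using sub2 by eventually_elim (use x y in blast)
    qed auto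
    then have "y \<longlonglongrightarrow> x" by (rule tendsto_dist_iff[THEN iffD2])
    with y show "x \<in> set_liminf C" unfolding set_liminf_def by blast
  qed
  moreover have "set_liminf C \<subseteq> set_limsup C"
  proof
    fix x assume "x \<in> set_liminf C"
    then obtain y where y: "\<forall>n. y n \<in> C n" "y \<longlonglongrightarrow> x" by (auto simp: set_liminf_def)
    show "x \<in> set_limsup C"
      unfolding set_limsup_def mem_Collect_eq
      by (rule exI[of _ "\<lambda>n. n"], rule exI[of _ y]) (use y in \<open>simp add: strict_mono_def\<close>)
  qed
  ultimately show ?thesis unfolding has_set_limit_def by blast
qed

text \<open>The factors \<open>1 / real n\<close> and \<open>h ^ CARD('d)\<close> cancel against the
  normaliser, and a Minkowski sum of scaled sets consists of the weighted sums of
  selections.\<close>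

lemma kernel_set_estimator_alt:
  fixes u :: "real ^ 'd::finite" and \<phi> :: "real \<Rightarrow> real" and x :: "nat \<Rightarrow> real ^ 'd"
    and T :: "nat \<Rightarrow> (real ^ 'q::finite) set" and k :: "nat \<Rightarrow> real"
  assumes "0 < h" "0 < n" and k: "\<And>i. k i = \<phi> (norm (x i - u) / h)"
  shows "kernel_set_estimator \<phi> h n x T u =
    (\<lambda>s. \<Sum>i<n. (k i / sum k {..<n}) *\<^sub>R s i) ` {s. \<forall>i<n. s i \<in> T i}"
proof -
  define H where "H = h ^ CARD('d)"
  have H: "H \<noteq> 0" using assms by (simp add: H_def)
  have sk: "scaled_kernel \<phi> h (x i - u) = k i / H" for i
    by (simp add: scaled_kernel_def k H_def)
  define D where "D = sum k {..<n}"
  have "(\<Sum>i<n. k i / H) = D / H"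
    by (simp add: D_def sum_divide_distrib)
  then have inv: "inverse (1 / real n * (\<Sum>i<n. k i / H)) = real n * H / D"
    by simp
  \<comment> \<open>For \<open>D = 0\<close> both sides are 0, since division by 0 yields 0.\<close>
  have *: "(real n * H / D) *\<^sub>R (1 / real n) *\<^sub>R (\<Sum>i<n. (k i / H) *\<^sub>R s i)
      = (\<Sum>i<n. (k i / D) *\<^sub>R s i)" for s :: "nat \<Rightarrow> real ^ 'q"
    using assms(2) H by (simp add: scaleR_sum_right)
  have "(\<Sum>i<n. (*\<^sub>R) (k i / H) ` T i) = (\<lambda>s. \<Sum>i<n. (k i / H) *\<^sub>R s i) ` {s. \<forall>i<n. s i \<in> T i}"
    (is "?L = ?R")
  proof (intro equalityI subsetI)
    fix y assume "y \<in> ?L"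
    then obtain s where s: "y = sum s {..<n}" "\<forall>i\<in>{..<n}. s i \<in> (*\<^sub>R) (k i / H) ` T i"
      unfolding set_sum_alt[OF finite_lessThan] by blast
    from s(2) have "\<forall>i. \<exists>t. i < n \<longrightarrow> t \<in> T i \<and> s i = (k i / H) *\<^sub>R t" by auto
    from choice[OF this] obtain t where t: "\<forall>i. i < n \<longrightarrow> t i \<in> T i \<and> s i = (k i / H) *\<^sub>R t i" by blast
    show "y \<in> ?R"
      by (rule image_eqI[of _ _ t]) (use s(1) t in auto)
  next
    fix y assume "y \<in> ?R"
    then obtain t where t: "y = (\<Sum>i<n. (k i / H) *\<^sub>R t i)" "\<forall>i<n. t i \<in> T i" by blast
    show "y \<in> ?L"
      unfolding set_sum_alt[OF finite_lessThan]
      by (rule CollectI, rule exI[of _ "\<lambda>i. (k i / H) *\<^sub>R t i"]) (use t in auto)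
  qed
  then have "kernel_set_estimator \<phi> h n x T u = (\<lambda>y. (real n * H / D) *\<^sub>R (1 / real n) *\<^sub>R y) `
      ((\<lambda>s. \<Sum>i<n. (k i / H) *\<^sub>R s i) ` {s. \<forall>i<n. s i \<in> T i})"
    unfolding kernel_set_estimator_def sk inv by (simp only: image_image)
  also have "\<dots> = (\<lambda>s. \<Sum>i<n. (k i / D) *\<^sub>R s i) ` {s. \<forall>i<n. s i \<in> T i}"
    unfolding image_image * ..
  finally show ?thesis unfolding D_def .
qed

lemma lipschitz_setfunD:
  assumes "lipschitz_setfun \<kappa> U S" "x \<in> U" "x' \<in> U" "a \<in> S x'"
  shows "\<exists>b\<in>S x. dist a b \<le> \<kappa> * norm (x' - x)"
proof -
  have "0 \<le> \<kappa>" and "S x' \<subseteq> S x + (*\<^sub>R) (\<kappa> * norm (x' - x)) ` cball 0 1"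
    using assms by (auto simp: lipschitz_setfun_def)
  then obtain b z where "b \<in> S x" "norm z \<le> 1" "a = b + (\<kappa> * norm (x' - x)) *\<^sub>R z"
    using assms(4) by (auto elim!: set_plus_elim)
  moreover have "norm ((\<kappa> * norm (x' - x)) *\<^sub>R z) \<le> \<kappa> * norm (x' - x)"
    using \<open>0 \<le> \<kappa>\<close> \<open>norm z \<le> 1\<close> by (simp add: mult_left_le)
  ultimately show ?thesis by (auto simp: dist_norm intro!: bexI[of _ b])
qed

text \<open>The normalised weights form a convex combination supported on indices with
  \<open>norm (x i - u) \<le> h\<close>. Each selected point is matched with a point of
  \<open>S u\<close> at distance at most \<open>\<kappa> * h\<close>, and convexity keeps the
  combination of the matches in \<open>S u\<close>. Conversely, \<open>s\<close> is the convex
  combination of copies of itself, each matched with a point of \<open>S (x i)\<close>. The noise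
  average is the same shift in both directions.\<close>

lemma kernel_set_estimator_dist:
  fixes u :: "real ^ 'd::finite" and S :: "real ^ 'd \<Rightarrow> (real ^ 'q::finite) set"
    and \<phi> :: "real \<Rightarrow> real" and x :: "nat \<Rightarrow> real ^ 'd" and w :: "nat \<Rightarrow> real ^ 'q" and n :: nat
  assumes h: "0 < h" "0 < n"
    and \<phi>: "\<And>t. 0 \<le> \<phi> t" "\<And>t. 1 \<le> \<bar>t\<bar> \<Longrightarrow> \<phi> t = 0"
    and S: "lipschitz_setfun \<kappa> U S" "convex (S u)"
    and x: "u \<in> U" "\<And>i. x i \<in> U"
  defines "k \<equiv> \<lambda>i. \<phi> (norm (x i - u) / h)"
  assumes pos: "0 < (\<Sum>i<n. k i)"
  defines "d \<equiv> \<kappa> * h + norm ((\<Sum>i<n. k i *\<^sub>R w i) /\<^sub>R (\<Sum>i<n. k i))"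
    and "E \<equiv> kernel_set_estimator \<phi> h n x (\<lambda>i. S (x i) + {w i}) u"
  shows "\<forall>y\<in>E. \<exists>s\<in>S u. dist y s \<le> d"
    and "\<forall>s\<in>S u. \<exists>y\<in>E. dist y s \<le> d"
proof -
  define p where "p i = k i / (\<Sum>i<n. k i)" for i
  have p: "0 \<le> p i" "(\<Sum>i<n. p i) = 1" for i
    using \<phi>(1) pos by (auto simp: p_def k_def sum_divide_distrib[symmetric])
  have \<kappa>: "0 \<le> \<kappa>" and ne: "\<And>x. x \<in> U \<Longrightarrow> S x \<noteq> {}"
    using S(1) by (auto simp: lipschitz_setfun_def)
  have E: "E = (\<lambda>s. \<Sum>i<n. p i *\<^sub>R s i) ` {s. \<forall>i<n. s i \<in> S (x i) + {w i}}"
    unfolding E_def p_def by (rule kernel_set_estimator_alt) (use h k_def in auto)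
  have near: "norm (x i - u) \<le> h" if "p i \<noteq> 0" for i
  proof (rule ccontr)
    assume "\<not> norm (x i - u) \<le> h"
    then have "\<phi> (norm (x i - u) / h) = 0" using h by (intro \<phi>(2)) (simp add: field_simps)
    then show False using that by (simp add: p_def k_def)
  qed
  have near': "\<kappa> * norm (x i - u) \<le> \<kappa> * h" if "p i \<noteq> 0" for i
    using near[OF that] \<kappa> by (rule mult_left_mono)
  have noise: "(\<Sum>i<n. p i *\<^sub>R w i) = (\<Sum>i<n. k i *\<^sub>R w i) /\<^sub>R (\<Sum>i<n. k i)"
    by (simp add: p_def scaleR_sum_right divide_inverse mult.commute)
  \<comment> \<open>One estimate serves both inclusions; closeness of \<open>a i\<close> and
    \<open>b i\<close> is demanded only where the weight is nonzero.\<close>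
  have main: "dist (\<Sum>i<n. p i *\<^sub>R (a i + w i)) (\<Sum>i<n. p i *\<^sub>R b i) \<le> d"
    if "\<And>i. i < n \<Longrightarrow> p i \<noteq> 0 \<Longrightarrow> dist (a i) (b i) \<le> \<kappa> * h" for a b
  proof -
    have split: "(\<Sum>i<n. p i *\<^sub>R (a i + w i)) - (\<Sum>i<n. p i *\<^sub>R b i)
      = (\<Sum>i<n. p i *\<^sub>R (a i - b i)) + (\<Sum>i<n. p i *\<^sub>R w i)"
      by (simp add: sum_subtractf[symmetric] sum.distrib[symmetric] algebra_simps)
    have "norm (\<Sum>i<n. p i *\<^sub>R (a i - b i)) \<le> (\<Sum>i<n. p i * (\<kappa> * h))"
    proof (rule sum_norm_le)
      fix i assume "i \<in> {..<n}"
      then show "norm (p i *\<^sub>R (a i - b i)) \<le> p i * (\<kappa> * h)"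
        using that[of i] p(1)[of i] by (cases "p i = 0") (auto simp: dist_norm intro!: mult_left_mono)
    qed
    also have "\<dots> = \<kappa> * h"
      using p(2) by (simp add: sum_distrib_right[symmetric])
    finally show ?thesis
      unfolding dist_norm d_def split noise by (rule norm_triangle_mono) simp
  qed
  show "\<forall>y\<in>E. \<exists>s\<in>S u. dist y s \<le> d"
  proof
    fix y assume "y \<in> E"
    then obtain s where s: "y = (\<Sum>i<n. p i *\<^sub>R s i)" "\<forall>i<n. s i \<in> S (x i) + {w i}"
      by (auto simp: E)
    define a where "a i = s i - w i" for i
    have a: "a i \<in> S (x i)" if "i < n" for i
    proof -
      have "s i \<in> S (x i) + {w i}" using s(2) that by blast
      then obtain c where "c \<in> S (x i)" "s i = c + w i" by (elim set_plus_elim) blast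
      then show ?thesis by (simp add: a_def)
    qed
    \<comment> \<open>For indices of zero weight \<open>b\<close> still has to lie in
      \<open>S u\<close>, but its distance to \<open>a i\<close> is left open.\<close>
    have "\<exists>b. b \<in> S u \<and> (p i \<noteq> 0 \<longrightarrow> dist (a i) b \<le> \<kappa> * h)" if i: "i < n" for i
    proof -
      obtain b where b: "b \<in> S u" "dist (a i) b \<le> \<kappa> * norm (x i - u)"
        using lipschitz_setfunD[OF S(1) x(1) x(2) a[OF i]] by blast
      from b(2) near'[of i] have "p i \<noteq> 0 \<longrightarrow> dist (a i) b \<le> \<kappa> * h" by auto
      with b(1) show ?thesis by blast
    qed
    then obtain b where b: "\<And>i. i < n \<Longrightarrow> b i \<in> S u \<and> (p i \<noteq> 0 \<longrightarrow> dist (a i) (b i) \<le> \<kappa> * h)"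
      by metis
    have "(\<Sum>i<n. p i *\<^sub>R b i) \<in> S u"
      by (rule convex_sum) (use p S(2) b in auto)
    moreover have y: "y = (\<Sum>i<n. p i *\<^sub>R (a i + w i))" by (simp add: s(1) a_def)
    have "dist y (\<Sum>i<n. p i *\<^sub>R b i) \<le> d" unfolding y by (rule main) (use b in blast)
    ultimately show "\<exists>s\<in>S u. dist y s \<le> d" by blast
  qed
  show "\<forall>s\<in>S u. \<exists>y\<in>E. dist y s \<le> d"
  proof
    fix s assume s: "s \<in> S u"
    have "\<exists>a. a \<in> S (x i) \<and> (p i \<noteq> 0 \<longrightarrow> dist a s \<le> \<kappa> * h)" for i
    proof -
      obtain a where a: "a \<in> S (x i)" "dist s a \<le> \<kappa> * norm (u - x i)"
        using lipschitz_setfunD[OF S(1) x(2) x(1) s, of i] by blast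
      from a(2) near'[of i] have "p i \<noteq> 0 \<longrightarrow> dist a s \<le> \<kappa> * h"
        by (auto simp: dist_commute norm_minus_commute)
      with a(1) show ?thesis by blast
    qed
    then obtain a where a: "\<And>i. a i \<in> S (x i) \<and> (p i \<noteq> 0 \<longrightarrow> dist (a i) s \<le> \<kappa> * h)" by metis
    have "(\<Sum>i<n. p i *\<^sub>R (a i + w i)) \<in> E"
    proof (unfold E, intro imageI CollectI)
      show "\<forall>i<n. a i + w i \<in> S (x i) + {w i}" using a by (blast intro: set_plus_intro)
    qed
    moreover have s_eq: "(\<Sum>i<n. p i *\<^sub>R s) = s"
      using p(2) by (simp add: scaleR_left.sum[symmetric])
    have "dist (\<Sum>i<n. p i *\<^sub>R (a i + w i)) (\<Sum>i<n. p i *\<^sub>R s) \<le> d"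
      by (rule main) (use a in blast)
    ultimately show "\<exists>y\<in>E. dist y s \<le> d" unfolding s_eq by blast
  qed
qed

lemma kernel_set_estimator_nonempty:
  assumes "\<And>i. T i \<noteq> {}"
  shows "kernel_set_estimator \<phi> h n x T u \<noteq> {}"
proof -
  define t where "t i = (SOME y. y \<in> T i)" for i
  have t: "t i \<in> T i" for i using assms by (simp add: t_def some_in_eq)
  have "(\<Sum>i<n. scaled_kernel \<phi> h (x i - u) *\<^sub>R t i)
      \<in> (\<Sum>i<n. (*\<^sub>R) (scaled_kernel \<phi> h (x i - u)) ` T i)"
    unfolding set_sum_alt[OF finite_lessThan] mem_Collect_eq
    by (intro exI[of _ "\<lambda>i. scaled_kernel \<phi> h (x i - u) *\<^sub>R t i"] conjI ballI imageI refl t)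
  then show ?thesis by (auto simp: kernel_set_estimator_def)
qed

subsection \<open>Lebesgue measure and radial kernels\<close>

text \<open>Change of variables \<open>x = u + h *\<^sub>R y\<close>. Besides the bandwidth scaling
  it covers pure dilations (\<open>u = 0\<close>) and pure translations
  (\<open>h = 1\<close>).\<close>

lemma emeasure_lborel_vimage_scale:
  fixes u :: "'a::euclidean_space"
  assumes [measurable]: "A \<in> sets borel" and h: "0 < h"
  shows "emeasure lborel {x. (x - u) /\<^sub>R h \<in> A} = ennreal (h ^ DIM('a)) * emeasure lborel A"
proof -
  have "emeasure lborel {x. (x - u) /\<^sub>R h \<in> A}
    = emeasure (density (distr lborel borel (\<lambda>x. u + h *\<^sub>R x)) (\<lambda>_. \<bar>h\<bar>^DIM('a))) {x. (x - u) /\<^sub>R h \<in> A}"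
    using h by (subst lborel_affine[of h u]) auto
  also have "\<dots> = ennreal (h ^ DIM('a)) * emeasure (distr lborel borel (\<lambda>x. u + h *\<^sub>R x)) {x. (x - u) /\<^sub>R h \<in> A}"
    using h by (subst emeasure_density) (auto simp: nn_integral_cmult_indicator)
  also have "emeasure (distr lborel borel (\<lambda>x. u + h *\<^sub>R x)) {x. (x - u) /\<^sub>R h \<in> A} = emeasure lborel A"
    using h by (subst emeasure_distr) (auto intro!: arg_cong[where f = "emeasure lborel"])
  finally show ?thesis .
qed

text \<open>Tonelli for the dilations \<open>x \<mapsto> t x\<close> with \<open>1 \<le> t \<le> 2\<close>: along each ray the
  exceptional dilations form a null set, so some dilation of the preimage is null, and hence
  the preimage itself.\<close>

lemma AE_lborel_norm:
  fixes P :: "real \<Rightarrow> bool"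
  assumes "AE t in lborel. P t"
  shows "AE x in (lborel :: 'a::euclidean_space measure). P (norm x)"
proof -
  obtain N where N: "N \<in> null_sets lborel" "{t. \<not> P t} \<subseteq> N"
    using assms by (auto elim!: AE_E simp: null_sets_def)
  have [measurable]: "N \<in> sets borel" using N by (auto simp: null_sets_def)
  have "(\<integral>\<^sup>+t. (\<integral>\<^sup>+x. indicator {1..2} t * indicator N (t * norm (x :: 'a)) \<partial>lborel) \<partial>lborel)
    = (\<integral>\<^sup>+x. (\<integral>\<^sup>+t. indicator {1..2} t * indicator N (t * norm (x :: 'a)) \<partial>lborel) \<partial>(lborel :: 'a measure))"
    by (rule lborel_pair.Fubini') measurable
  also have "\<dots> = (\<integral>\<^sup>+x. 0 \<partial>(lborel :: 'a measure))"
  proof (rule nn_integral_cong_AE)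
    \<comment> \<open>For \<open>x \<noteq> 0\<close> the map \<open>t \<mapsto> t * norm x\<close>
      is an invertible linear map of the line, so it pulls the null set \<open>N\<close> back to a
      null set; the origin itself is null.\<close>
    show "AE x in (lborel :: 'a measure). (\<integral>\<^sup>+t. indicator {1..2::real} t * indicator N (t * norm x) \<partial>lborel) = (0::ennreal)"
      using AE_lborel_singleton[of 0]
    proof eventually_elim
      case (elim x)
      have "0 = emeasure lborel N" using N by (auto simp: null_sets_def)
      also have "\<dots> = (\<integral>\<^sup>+t. indicator N t \<partial>lborel)" by simp
      also have "\<dots> = ennreal \<bar>norm x\<bar> * (\<integral>\<^sup>+t. indicator N (0 + norm x * t) \<partial>lborel)"
        by (rule nn_integral_real_affine) (use elim in auto)
      finally have "(\<integral>\<^sup>+t. indicator N (t * norm x) \<partial>lborel) = (0::ennreal)"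
        using elim by (auto simp: mult.commute)
      moreover have "(\<integral>\<^sup>+t. indicator {1..2} t * indicator N (t * norm x) \<partial>lborel)
          \<le> (\<integral>\<^sup>+t. indicator N (t * norm x) \<partial>lborel)"
        by (intro nn_integral_mono) (auto simp: indicator_def)
      ultimately show ?case by simp
    qed
  qed
  finally have "(\<integral>\<^sup>+t. (\<integral>\<^sup>+x. indicator {1..2} t * indicator N (t * norm (x :: 'a)) \<partial>lborel) \<partial>lborel) = 0"
    by simp
  then have "AE t in lborel. (\<integral>\<^sup>+x. indicator {1..2::real} t * indicator N (t * norm (x :: 'a)) \<partial>lborel) = (0::ennreal)"
    by (subst (asm) nn_integral_0_iff_AE) auto
  then have AE_t: "AE t in lborel. t \<in> {1..2} \<longrightarrow> (\<integral>\<^sup>+x. indicator N (t * norm (x :: 'a)) \<partial>lborel) = (0::ennreal)"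
    by eventually_elim auto
  have "\<exists>t\<in>{1..2}. (\<integral>\<^sup>+x. indicator N (t * norm (x :: 'a)) \<partial>lborel) = (0::ennreal)"
  proof (rule ccontr)
    assume "\<not> ?thesis"
    with AE_t have "AE t in lborel. t \<notin> {1..2::real}" by (auto elim!: eventually_mono)
    then show False by (subst (asm) AE_iff_measurable[of "{1..2}"]) auto
  qed
  then obtain t :: real where t: "t \<in> {1..2}"
      "(\<integral>\<^sup>+x. indicator N (t * norm (x :: 'a)) \<partial>lborel) = (0::ennreal)" by blast
  let ?A = "{x :: 'a. t * norm x \<in> N}"
  have "(\<integral>\<^sup>+x. indicator N (t * norm (x :: 'a)) \<partial>lborel) = (\<integral>\<^sup>+x. indicator ?A x \<partial>lborel)"
    by (intro nn_integral_cong) (auto simp: indicator_def)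
  also have "\<dots> = emeasure lborel ?A"
    by (rule nn_integral_indicator) measurable
  finally have "emeasure lborel ?A = 0" using t by simp
  \<comment> \<open>Dilating \<open>?A\<close> by \<open>t\<close> yields exactly
    \<open>{x. norm x \<in> N}\<close>, which is therefore null as well.\<close>
  moreover have "emeasure lborel {x. (x - 0) /\<^sub>R t \<in> ?A} = ennreal (t ^ DIM('a)) * emeasure lborel ?A"
    by (rule emeasure_lborel_vimage_scale) (use t in auto)
  moreover have "{x. (x - 0) /\<^sub>R t \<in> ?A} = {x. norm x \<in> N}"
    using t by (simp add: mult.assoc[symmetric])
  ultimately have "{x :: 'a. norm x \<in> N} \<in> null_sets lborel"
    by (auto simp: null_sets_def)
  then show ?thesis
    by (rule AE_I') (use N in auto)
qed

text \<open>The point \<open>u\<close> may lie on the boundary of \<open>U\<close>, so no full ball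
  around it is available. Instead \<open>U\<close> is contracted towards \<open>u\<close>: by
  convexity the copy stays in \<open>U\<close>, it has positive measure, and it lies where the
  kernel is positive almost everywhere. If all level regions were null, this copy would be null
  too.\<close>

lemma positive_kernel_region:
  fixes U :: "'a::euclidean_space set" and \<phi> :: "real \<Rightarrow> real"
  assumes "convex U" "compact U" "u \<in> U" and U: "emeasure lborel U \<noteq> 0"
    and [measurable]: "\<phi> \<in> borel_measurable borel"
    and \<phi>: "AE t in lborel. \<bar>t\<bar> \<le> \<eta> \<longrightarrow> 0 < \<phi> t" "0 < \<eta>"
  shows "\<exists>\<epsilon>>0. emeasure lborel {v. u + v \<in> U \<and> \<epsilon> \<le> \<phi> (norm v)} \<noteq> 0"
proof (rule ccontr)
  assume contr: "\<not> (\<exists>\<epsilon>>0. emeasure lborel {v. u + v \<in> U \<and> \<epsilon> \<le> \<phi> (norm v)} \<noteq> 0)"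
  have [measurable]: "U \<in> sets borel" using \<open>compact U\<close> by (simp add: borel_compact)
  have null: "AE v in lborel. \<not> (u + v \<in> U \<and> inverse (real (Suc m)) \<le> \<phi> (norm v))" for m
  proof (subst AE_iff_measurable[OF _ refl])
    have "0 < inverse (real (Suc m))" by simp
    then show "emeasure lborel {v \<in> space lborel. \<not> \<not> (u + v \<in> U \<and> inverse (real (Suc m)) \<le> \<phi> (norm v))} = 0"
      using contr by (auto simp: space_lborel simp del: of_nat_Suc)
  qed measurable
  have 1: "AE v in lborel. \<forall>m. \<not> (u + v \<in> U \<and> inverse (real (Suc m)) \<le> \<phi> (norm v))"
    by (subst AE_all_countable) (use null in blast)
  obtain R where R: "0 < R" "\<And>x. x \<in> U \<Longrightarrow> norm x \<le> R"
    using compact_imp_bounded[OF \<open>compact U\<close>] by (auto simp: bounded_pos)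
  \<comment> \<open>Points of \<open>U\<close> are at most \<open>2 * R\<close> apart, so a
    contraction by \<open>t\<close> brings them within \<open>\<eta>\<close> of \<open>u\<close>;
    the cap at 1 keeps it a convex combination.\<close>
  define t where "t = min 1 (\<eta> / (2 * R))"
  have t: "0 < t" "t \<le> 1" "t * (2 * R) \<le> \<eta>"
    using R \<phi>(2) by (auto simp: t_def min_def field_simps)
  have "AE v in lborel. \<bar>norm (v :: 'a)\<bar> \<le> \<eta> \<longrightarrow> 0 < \<phi> (norm v)"
    by (rule AE_lborel_norm[OF \<phi>(1)])
  with 1 have "AE v in lborel. v \<notin> {v. (v - 0) /\<^sub>R t \<in> {v. u + v \<in> U}}"
  proof eventually_elim
    case (elim v)
    show ?case
    proof
      assume "v \<in> {v. (v - 0) /\<^sub>R t \<in> {v. u + v \<in> U}}"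
      then have y: "u + v /\<^sub>R t \<in> U" by simp
      define y where "y = u + v /\<^sub>R t"
      have v: "v = t *\<^sub>R (y - u)" using t by (simp add: y_def)
      have "norm (y - u) \<le> 2 * R"
        using R(2)[of y] R(2)[of u] y \<open>u \<in> U\<close> norm_triangle_ineq4[of y u] by (simp add: y_def)
      then have "norm v \<le> \<eta>" using t by (simp add: v) (meson mult_left_mono order_trans less_imp_le)
      moreover have "u + v = (1 - t) *\<^sub>R u + t *\<^sub>R y" by (simp add: v algebra_simps)
      then have "u + v \<in> U" using convexD_alt[OF \<open>convex U\<close> \<open>u \<in> U\<close>, of y t] y t by (simp add: y_def)
      ultimately have "0 < \<phi> (norm v)" "u + v \<in> U" using elim(2) by auto
      moreover obtain m where "inverse (real (Suc m)) < \<phi> (norm v)"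
        using reals_Archimedean calculation(1) by blast
      ultimately show False using elim(1) by (meson less_imp_le)
    qed
  qed
  then have "emeasure lborel {v. (v - 0) /\<^sub>R t \<in> {v. u + v \<in> U}} = 0"
    by (subst (asm) AE_iff_measurable[of "{v. (v - 0) /\<^sub>R t \<in> {v. u + v \<in> U}}"]) auto
  then have "emeasure lborel {v. u + v \<in> U} = 0"
    using t by (subst (asm) emeasure_lborel_vimage_scale) auto
  \<comment> \<open>Translation by \<open>u\<close> carries \<open>{v. u + v \<in> U}\<close> to
    \<open>U\<close>, contradicting its positive measure.\<close>
  moreover have "emeasure lborel {x. (x - u) /\<^sub>R 1 \<in> {v. u + v \<in> U}} = ennreal (1 ^ DIM('a)) * emeasure lborel {v. u + v \<in> U}"
    by (rule emeasure_lborel_vimage_scale) auto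
  ultimately show False using U by simp
qed

subsection \<open>Counting sample points near the target\<close>

text \<open>Markov's inequality for the exponential of the count: one indicator of probability
  \<open>p\<close> contributes the factor \<open>1 + (exp l - 1) * p \<le> exp b\<close>, and
  independence multiplies the factors. The sign of \<open>l\<close> is free, so the same bound
  serves both tails.\<close>

lemma (in prob_space) count_Chernoff_bound:
  fixes X :: "nat \<Rightarrow> 'a \<Rightarrow> 'b::topological_space"
  assumes ind: "indep_vars (\<lambda>_. borel) X UNIV" and [measurable]: "A \<in> sets borel"
    and b: "\<And>i. prob {\<omega> \<in> space M. X i \<omega> \<in> A} * (exp l - 1) \<le> b"
  shows "prob {\<omega> \<in> space M. a \<le> l * (\<Sum>i<m. indicator A (X i \<omega>))} \<le> exp (real m * b - a)"
proof -
  have [measurable]: "random_variable borel (X i)" for i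
    using ind by (auto simp: indep_vars_def)
  define Y where "Y i \<omega> = exp (l * indicator A (X i \<omega>))" for i \<omega>
  have [measurable]: "random_variable borel (Y i)" for i
    unfolding Y_def[abs_def] by measurable
  have Y_eq: "Y i \<omega> = 1 + (exp l - 1) * indicator {\<omega> \<in> space M. X i \<omega> \<in> A} \<omega>" if "\<omega> \<in> space M" for i \<omega>
    using that by (auto simp: Y_def indicator_def)
  have Y_int: "integrable M (Y i)" for i
    by (subst Bochner_Integration.integrable_cong[OF refl Y_eq]) (auto intro!: integrable_real_indicator simp: emeasure_eq_measure)
  have "expectation (Y i) = 1 + (exp l - 1) * prob {\<omega> \<in> space M. X i \<omega> \<in> A}" for i
    by (subst Bochner_Integration.integral_cong[OF refl Y_eq])
      (auto simp: prob_space emeasure_eq_measure intro!: integrable_real_indicator)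
  then have "expectation (Y i) \<le> exp b" for i
    using b[of i] order_trans[OF _ exp_ge_add_one_self[of b]] by (simp add: mult.commute)
  moreover have "0 \<le> expectation (Y i)" for i
    by (rule Bochner_Integration.integral_nonneg) (simp add: Y_def)
  ultimately have "(\<Prod>i<m. expectation (Y i)) \<le> (\<Prod>i<m. exp b)"
    by (intro prod_mono) auto
  then have prod_le: "(\<Prod>i<m. expectation (Y i)) \<le> exp (real m * b)"
    by (simp add: exp_of_nat_mult)
  have ind_Y: "indep_vars (\<lambda>_. borel) Y {..<m}"
    unfolding Y_def[abs_def] by (rule indep_vars_compose2[OF indep_vars_subset[OF ind]]) auto
  have Y_prod: "exp (l * (\<Sum>i<m. indicator A (X i \<omega>))) = (\<Prod>i<m. Y i \<omega>)" for \<omega>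
    unfolding Y_def sum_distrib_left by (rule exp_sum) simp
  have "prob {\<omega> \<in> space M. a \<le> l * (\<Sum>i<m. indicator A (X i \<omega>))}
    = prob {\<omega> \<in> space M. exp a \<le> (\<Prod>i<m. Y i \<omega>)}"
    unfolding Y_prod[symmetric] by simp
  also have "\<dots> \<le> expectation (\<lambda>\<omega>. \<Prod>i<m. Y i \<omega>) / exp a"
    using indep_vars_integrable[OF _ ind_Y] Y_int
    by (intro integral_Markov_inequality_measure[where A = "{}"]) (auto simp: Y_def intro!: prod_nonneg)
  also have "expectation (\<lambda>\<omega>. \<Prod>i<m. Y i \<omega>) = (\<Prod>i<m. expectation (Y i))"
    by (rule indep_vars_lebesgue_integral[OF _ ind_Y]) (auto intro: Y_int)
  also have "\<dots> / exp a \<le> exp (real m * b) / exp a"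
    using prod_le by (intro divide_right_mono) auto
  finally show ?thesis by (simp add: exp_diff)
qed

text \<open>Chernoff's bound with \<open>l = - 1\<close>: from \<open>exp (- 1) \<le> 1 / 2\<close>
  the expected count contributes at most \<open>- (c / 2) * real n powr g\<close> to the exponent,
  and the threshold \<open>c / 4\<close> gives back only half of that.\<close>

lemma (in prob_space) count_ge_AE:
  fixes X :: "nat \<Rightarrow> 'a \<Rightarrow> 'b::topological_space"
  assumes ind: "indep_vars (\<lambda>_. borel) X UNIV" and [measurable]: "\<And>n. A n \<in> sets borel"
    and pos: "0 < c" "0 < g"
    and P: "\<forall>\<^sub>F n in sequentially. \<forall>i. c * real n powr g \<le> real n * prob {\<omega> \<in> space M. X i \<omega> \<in> A n}"
  shows "AE \<omega> in M. \<forall>\<^sub>F n in sequentially. c / 4 * real n powr g \<le> (\<Sum>i<n. indicator (A n) (X i \<omega>))"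
proof -
  have [measurable]: "random_variable borel (X i)" for i
    using ind by (auto simp: indep_vars_def)
  have "AE \<omega> in M. \<forall>\<^sub>F n in sequentially.
      \<not> (- (c / 4 * real n powr g) \<le> - 1 * (\<Sum>i<n. indicator (A n) (X i \<omega>)))"
  proof (rule AE_eventually_not[where g = "\<lambda>n. exp (- (c / 4 * real n powr g))"])
    show "\<forall>\<^sub>F n in sequentially. prob {\<omega> \<in> space M. - (c / 4 * real n powr g) \<le>
        - 1 * (\<Sum>i<n. indicator (A n) (X i \<omega>))} \<le> exp (- (c / 4 * real n powr g))"
      using P eventually_gt_at_top[of 0]
    proof eventually_elim
      case (elim n)
      define p where "p = c * real n powr g / real n"
      have "prob {\<omega> \<in> space M. - (c / 4 * real n powr g) \<le> - 1 * (\<Sum>i<n. indicator (A n) (X i \<omega>))}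
        \<le> exp (real n * - (p / 2) - - (c / 4 * real n powr g))"
      proof (rule count_Chernoff_bound[OF ind])
        fix i
        have "p \<le> prob {\<omega> \<in> space M. X i \<omega> \<in> A n}"
          using elim by (simp add: p_def field_simps)
        moreover have "exp (- 1) \<le> (1 / 2 :: real)"
          using exp_ge_add_one_self[of "1::real"] by (simp add: exp_minus field_simps)
        then have "prob {\<omega> \<in> space M. X i \<omega> \<in> A n} * (exp (- 1) - 1)
            \<le> prob {\<omega> \<in> space M. X i \<omega> \<in> A n} * (- (1 / 2))"
          by (intro mult_left_mono) auto
        ultimately show "prob {\<omega> \<in> space M. X i \<omega> \<in> A n} * (exp (- 1) - 1) \<le> - (p / 2)"
          by linarith
      qed measurable
      also have "real n * - (p / 2) - - (c / 4 * real n powr g) = - (c / 4 * real n powr g)"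
        using elim by (simp add: p_def)
      finally show ?case .
    qed
    show "summable (\<lambda>n. exp (- (c / 4 * real n powr g)))"
      by (rule summable_exp_powr) (use pos in auto)
  qed measurable
  then show ?thesis by eventually_elim (auto elim!: eventually_mono)
qed

text \<open>Chernoff's bound with \<open>l = 1\<close>: since \<open>exp 1 - 1 \<le> 2\<close>, the
  expected count contributes at most \<open>2 * q j\<close>, and the threshold
  \<open>4 * q j\<close> leaves the exponent \<open>- (2 * q j)\<close>.\<close>

lemma (in prob_space) count_less_AE:
  fixes X :: "nat \<Rightarrow> 'a \<Rightarrow> 'b::topological_space"
  assumes ind: "indep_vars (\<lambda>_. borel) X UNIV" and [measurable]: "\<And>j. A j \<in> sets borel"
    and m: "\<And>j. 0 < m j"
    and P: "\<And>i j. real (m j) * prob {\<omega> \<in> space M. X i \<omega> \<in> A j} \<le> q j"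
    and q: "summable (\<lambda>j. exp (- (2 * q j)))"
  shows "AE \<omega> in M. \<forall>\<^sub>F j in sequentially. (\<Sum>i<m j. indicator (A j) (X i \<omega>)) < 4 * q j"
proof -
  have [measurable]: "random_variable borel (X i)" for i
    using ind by (auto simp: indep_vars_def)
  have "AE \<omega> in M. \<forall>\<^sub>F j in sequentially. \<not> (4 * q j \<le> 1 * (\<Sum>i<m j. indicator (A j) (X i \<omega>)))"
  proof (rule AE_eventually_not[OF _ always_eventually q], measurable, intro allI)
    fix j
    have "prob {\<omega> \<in> space M. 4 * q j \<le> 1 * (\<Sum>i<m j. indicator (A j) (X i \<omega>))}
      \<le> exp (real (m j) * (2 * q j / m j) - 4 * q j)"
    proof (rule count_Chernoff_bound[OF ind])
      fix i
      have "prob {\<omega> \<in> space M. X i \<omega> \<in> A j} * (exp 1 - 1) \<le> prob {\<omega> \<in> space M. X i \<omega> \<in> A j} * 2"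
        using exp_le by (intro mult_left_mono) auto
      also have "\<dots> \<le> 2 * q j / m j"
        using P[of j i] m[of j] by (simp add: field_simps)
      finally show "prob {\<omega> \<in> space M. X i \<omega> \<in> A j} * (exp 1 - 1) \<le> 2 * q j / m j" .
    qed measurable
    also have "real (m j) * (2 * q j / m j) - 4 * q j = - (2 * q j)"
      using m[of j] by simp
    finally show "prob {\<omega> \<in> space M. 4 * q j \<le> 1 * (\<Sum>i<m j. indicator (A j) (X i \<omega>))} \<le> exp (- (2 * q j))" .
  qed
  then show ?thesis by (simp add: not_le)
qed

lemma (in prob_space) distributed_prob_ge:
  assumes X: "distributed M lborel X (\<lambda>x. ennreal (f x))"
    and A: "A \<in> sets borel" "\<And>x. x \<in> A \<Longrightarrow> a \<le> f x" "0 \<le> a"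
  shows "ennreal a * emeasure lborel A \<le> ennreal (prob {\<omega> \<in> space M. X \<omega> \<in> A})"
proof -
  have "ennreal a * emeasure lborel A = (\<integral>\<^sup>+x. ennreal a * indicator A x \<partial>lborel)"
    using A by (simp add: nn_integral_cmult_indicator)
  also have "\<dots> \<le> (\<integral>\<^sup>+x. ennreal (f x) * indicator A x \<partial>lborel)"
    using A by (intro nn_integral_mono) (auto simp: indicator_def intro!: ennreal_leI)
  also have "\<dots> = emeasure M (X -` A \<inter> space M)"
    using distributed_emeasure[OF X, of A] A by simp
  also have "\<dots> = ennreal (prob {\<omega> \<in> space M. X \<omega> \<in> A})"
    by (simp add: emeasure_eq_measure vimage_def Int_def conj_commute)
  finally show ?thesis .
qed

lemma (in prob_space) distributed_prob_le:
  assumes X: "distributed M lborel X (\<lambda>x. ennreal (f x))" and U: "\<And>\<omega>. \<omega> \<in> space M \<Longrightarrow> X \<omega> \<in> U"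
    and A: "A \<in> sets borel" "U \<in> sets borel" "\<And>x. x \<in> U \<Longrightarrow> f x \<le> b"
  shows "ennreal (prob {\<omega> \<in> space M. X \<omega> \<in> A}) \<le> ennreal b * emeasure lborel A"
proof -
  \<comment> \<open>Intersecting with \<open>U\<close> loses no probability and brings the integral
    to where \<open>f\<close> is bounded by \<open>b\<close>.\<close>
  have "ennreal (prob {\<omega> \<in> space M. X \<omega> \<in> A}) = emeasure M (X -` (A \<inter> U) \<inter> space M)"
    using U by (auto simp: emeasure_eq_measure intro!: arg_cong[where f = prob])
  also have "\<dots> = (\<integral>\<^sup>+x. ennreal (f x) * indicator (A \<inter> U) x \<partial>lborel)"
    using distributed_emeasure[OF X, of "A \<inter> U"] A by simp
  also have "\<dots> \<le> (\<integral>\<^sup>+x. ennreal b * indicator A x \<partial>lborel)"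
    using A by (intro nn_integral_mono) (auto simp: indicator_def intro!: ennreal_leI)
  also have "\<dots> = ennreal b * emeasure lborel A"
    using A by (simp add: nn_integral_cmult_indicator)
  finally show ?thesis .
qed

text \<open>Both expected counts are of order \<open>real n * h n ^ DIM('b) = real n powr g\<close>,
  because the density lies between positive constants on the compact set \<open>U\<close>. Below,
  one counts sample points in the dilates of a fixed region where the kernel is at least
  \<open>\<epsilon>\<close>; above, sample points in a ball of radius
  \<open>h (2 ^ j)\<close>.\<close>

lemma (in prob_space) kernel_design_AE:
  fixes X :: "nat \<Rightarrow> 'a \<Rightarrow> 'b::euclidean_space" and f :: "'b \<Rightarrow> real" and h :: "nat \<Rightarrow> real"
  assumes ind: "indep_vars (\<lambda>_. borel) X UNIV"
    and U: "convex U" "compact U" "u \<in> U"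
    and X: "\<And>i \<omega>. \<omega> \<in> space M \<Longrightarrow> X i \<omega> \<in> U"
      "\<And>i. distributed M lborel (X i) (\<lambda>x. ennreal (f x))"
    and f: "continuous_on U f" "\<And>x. x \<in> U \<Longrightarrow> 0 < f x"
    and \<psi>[measurable]: "\<psi> \<in> borel_measurable borel" and \<psi>_nonneg: "\<And>t. 0 \<le> \<psi> t"
    and \<psi>_pos: "AE t in lborel. \<bar>t\<bar> \<le> \<eta> \<longrightarrow> 0 < \<psi> t" "0 < \<eta>"
    and h: "\<And>n. h n = real n powr (- 1 / (real DIM('b) + 4))"
    and g: "g = 4 / (real DIM('b) + 4)"
  shows "\<exists>c>0. \<exists>C>0. AE \<omega> in M.
    (\<forall>\<^sub>F n in sequentially. c * real n powr g \<le> (\<Sum>i<n. \<psi> (norm (X i \<omega> - u) / h n))) \<and>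
    (\<forall>\<^sub>F j in sequentially.
      real (card {i. i < 2 ^ Suc j \<and> norm (X i \<omega> - u) \<le> h (2 ^ j)}) \<le> C * (2 ^ j) powr g)"
proof -
  have g_pos: "0 < g" by (simp add: g)
  have h_pos: "0 < h n" if "0 < n" for n using that by (simp add: h)
  have h_le: "h n \<le> 1" if "0 < n" for n
    using that by (simp add: h powr_minus_divide field_simps ge_one_powr_ge_zero)
  have h_pow: "real n * h n ^ DIM('b) = real n powr g" if "0 < n" for n
  proof -
    have "h n ^ DIM('b) = real n powr (- real DIM('b) / (real DIM('b) + 4))"
      using that by (simp add: h powr_power)
    then have "real n * h n ^ DIM('b) = real n powr (1 + - real DIM('b) / (real DIM('b) + 4))"
      using that unfolding powr_add by simp
    also have "1 + - real DIM('b) / (real DIM('b) + 4) = g"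
      by (simp add: g field_simps)
    finally show ?thesis .
  qed
  have [measurable]: "U \<in> sets borel" using U(2) by (simp add: borel_compact)
  obtain a where a: "0 < a" "\<And>x. x \<in> U \<Longrightarrow> a \<le> f x"
    using continuous_attains_inf[OF U(2) _ f(1)] U(3) f(2) by (metis empty_iff)
  obtain b where b: "0 < b" "\<And>x. x \<in> U \<Longrightarrow> f x \<le> b"
    using continuous_attains_sup[OF U(2) _ f(1)] U(3) f(2) by (metis empty_iff)
  \<comment> \<open>\<open>U\<close> carries the whole mass of a density bounded on it, so it cannot
    be a Lebesgue null set.\<close>
  have "{\<omega> \<in> space M. X 0 \<omega> \<in> U} = space M" using X(1) by auto
  then have "emeasure lborel U \<noteq> 0"
    using distributed_prob_le[OF X(2)[of 0] X(1), where A = U and b = b] b by (auto simp: prob_space)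
  then obtain \<epsilon> where \<epsilon>: "0 < \<epsilon>" and E0: "emeasure lborel {v. u + v \<in> U \<and> \<epsilon> \<le> \<psi> (norm v)} \<noteq> 0"
    using positive_kernel_region[OF U _ \<psi> \<psi>_pos] by blast
  define E where "E = {v. u + v \<in> U \<and> \<epsilon> \<le> \<psi> (norm v)}"
  have [measurable]: "E \<in> sets borel" unfolding E_def by measurable
  have "E \<subseteq> (\<lambda>x. x - u) ` U"
    by (auto simp: E_def image_iff intro!: bexI[of _ "u + _"])
  moreover have "bounded ((\<lambda>x. x - u) ` U)"
    by (intro compact_imp_bounded compact_continuous_image U continuous_intros)
  ultimately have "emeasure lborel E < \<infinity>"
    by (intro emeasure_bounded_finite) (rule bounded_subset)
  then have E: "emeasure lborel E = ennreal (measure lborel E)"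
    by (intro emeasure_eq_ennreal_measure) auto
  define \<kappa> where "\<kappa> = measure lborel E"
  have \<kappa>: "0 < \<kappa>" using E0 E unfolding E_def[symmetric] \<kappa>_def
    by (metis ennreal_0 measure_nonneg order_le_less)
  have lower: "AE \<omega> in M. \<forall>\<^sub>F n in sequentially. a * \<kappa> / 4 * real n powr g
      \<le> (\<Sum>i<n. indicator {x. (x - u) /\<^sub>R h n \<in> E} (X i \<omega>))"
  proof (rule count_ge_AE[OF ind])
    show "\<forall>\<^sub>F n in sequentially. \<forall>i. a * \<kappa> * real n powr g
        \<le> real n * prob {\<omega> \<in> space M. X i \<omega> \<in> {x. (x - u) /\<^sub>R h n \<in> E}}"
      using eventually_gt_at_top[of 0]
    proof eventually_elim
      case (elim n)
      \<comment> \<open>Since \<open>h n \<le> 1\<close>, \<open>x\<close> lies on the segment from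
        \<open>u\<close> to a point of \<open>U\<close>; thus the dilated region stays where the
        density is at least \<open>a\<close>.\<close>
      have "x \<in> U" if "(x - u) /\<^sub>R h n \<in> E" for x
      proof -
        have "u + (x - u) /\<^sub>R h n \<in> U" using that by (simp add: E_def)
        then have "(1 - h n) *\<^sub>R u + h n *\<^sub>R (u + (x - u) /\<^sub>R h n) \<in> U"
          using U h_pos[OF elim] h_le[OF elim] by (intro convexD_alt) auto
        moreover have "(1 - h n) *\<^sub>R u + h n *\<^sub>R (u + (x - u) /\<^sub>R h n) = x"
          using h_pos[OF elim] by (simp add: algebra_simps)
        ultimately show ?thesis by simp
      qed
      then have "ennreal a * emeasure lborel {x. (x - u) /\<^sub>R h n \<in> E}
          \<le> ennreal (prob {\<omega> \<in> space M. X i \<omega> \<in> {x. (x - u) /\<^sub>R h n \<in> E}})" for i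
        by (intro distributed_prob_ge[OF X(2)]) (use a in auto)
      then have "ennreal (a * (h n ^ DIM('b) * \<kappa>))
          \<le> ennreal (prob {\<omega> \<in> space M. X i \<omega> \<in> {x. (x - u) /\<^sub>R h n \<in> E}})" for i
        using a h_pos[OF elim] \<kappa>
        by (subst (asm) emeasure_lborel_vimage_scale) (auto simp: E \<kappa>_def ennreal_mult)
      then have "a * (h n ^ DIM('b) * \<kappa>) \<le> prob {\<omega> \<in> space M. X i \<omega> \<in> {x. (x - u) /\<^sub>R h n \<in> E}}" for i
        by simp
      then have "real n * (a * (h n ^ DIM('b) * \<kappa>))
          \<le> real n * prob {\<omega> \<in> space M. X i \<omega> \<in> {x. (x - u) /\<^sub>R h n \<in> E}}" for i
        by (rule mult_left_mono) simp
      then show ?case using h_pow[OF elim] by (simp add: algebra_simps)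
    qed
  qed (use a \<kappa> g_pos in auto)
  define V where "V = measure lborel (cball (0::'b) 1)"
  have V: "0 < V" by (simp add: V_def content_cball_pos)
  have V_eq: "emeasure lborel (cball (0::'b) 1) = ennreal V"
    unfolding V_def by (intro emeasure_eq_ennreal_measure) (use emeasure_bounded_finite[of "cball (0::'b) 1"] in auto)
  \<comment> \<open>The sample of size \<open>2 ^ Suc j\<close> contains all samples of the block
    that starts at \<open>2 ^ j\<close>; this doubling gives the factor 2 in the bound on the
    expected count.\<close>
  have upper: "AE \<omega> in M. \<forall>\<^sub>F j in sequentially.
      (\<Sum>i<2 ^ Suc j. indicator (cball u (h (2 ^ j))) (X i \<omega>)) < 4 * (2 * b * V * (2 ^ j) powr g)"
  proof (rule count_less_AE[OF ind])
    fix i j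
    have hj: "0 < h (2 ^ j)" by (rule h_pos) simp
    have ball: "cball u (h (2 ^ j)) = {x. (x - u) /\<^sub>R h (2 ^ j) \<in> cball 0 1}"
      using hj by (auto simp: dist_norm norm_minus_commute inverse_eq_divide pos_divide_le_eq)
    have "emeasure lborel {x. (x - u) /\<^sub>R h (2 ^ j) \<in> cball 0 1}
        = ennreal (h (2 ^ j) ^ DIM('b)) * emeasure lborel (cball (0::'b) 1)"
      by (rule emeasure_lborel_vimage_scale) (use hj in auto)
    then have "emeasure lborel (cball u (h (2 ^ j))) = ennreal (h (2 ^ j) ^ DIM('b) * V)"
      unfolding ball V_eq using hj V by (simp only: ennreal_mult zero_le_power less_imp_le)
    then have "ennreal (prob {\<omega> \<in> space M. X i \<omega> \<in> cball u (h (2 ^ j))}) \<le> ennreal (b * (h (2 ^ j) ^ DIM('b) * V))"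
      using distributed_prob_le[OF X(2)[of i] X(1), where A = "cball u (h (2 ^ j))" and b = b] b hj V
      by (simp add: ennreal_mult)
    then have "prob {\<omega> \<in> space M. X i \<omega> \<in> cball u (h (2 ^ j))} \<le> b * (h (2 ^ j) ^ DIM('b) * V)"
      using b hj V by simp
    then have "real (2 ^ Suc j) * prob {\<omega> \<in> space M. X i \<omega> \<in> cball u (h (2 ^ j))}
        \<le> real (2 ^ Suc j) * (b * (h (2 ^ j) ^ DIM('b) * V))"
      by (rule mult_left_mono) simp
    also have "\<dots> = 2 * b * V * (real (2 ^ j) * h (2 ^ j) ^ DIM('b))"
      by simp
    also have "\<dots> = 2 * b * V * (2 ^ j) powr g"
      by (subst h_pow) simp_all
    finally show "real (2 ^ Suc j) * prob {\<omega> \<in> space M. X i \<omega> \<in> cball u (h (2 ^ j))}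
        \<le> 2 * b * V * (2 ^ j) powr g" .
  next
    show "summable (\<lambda>j. exp (- (2 * (2 * b * V * (2 ^ j) powr g))))"
    proof (rule summable_comparison_test'[of "\<lambda>j. exp (- (4 * b * V * real j powr g))" 0])
      show "summable (\<lambda>j. exp (- (4 * b * V * real j powr g)))"
        by (rule summable_exp_powr) (use b V g_pos in auto)
      fix j :: nat
      have "real j \<le> 2 ^ j" using less_exp[of j] by (metis less_imp_le of_nat_le_iff of_nat_numeral of_nat_power)
      then have "real j powr g \<le> (2 ^ j) powr g" using g_pos by (intro powr_mono2) auto
      then have "4 * b * V * real j powr g \<le> 4 * b * V * (2 ^ j) powr g"
        using b V by (intro mult_left_mono) auto
      then show "norm (exp (- (2 * (2 * b * V * (2 ^ j) powr g)))) \<le> exp (- (4 * b * V * real j powr g))"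
        by simp
    qed
  qed auto
  have "AE \<omega> in M.
    (\<forall>\<^sub>F n in sequentially. \<epsilon> * a * \<kappa> / 4 * real n powr g \<le> (\<Sum>i<n. \<psi> (norm (X i \<omega> - u) / h n))) \<and>
    (\<forall>\<^sub>F j in sequentially.
      real (card {i. i < 2 ^ Suc j \<and> norm (X i \<omega> - u) \<le> h (2 ^ j)}) \<le> 8 * b * V * (2 ^ j) powr g)"
    using lower upper
  proof eventually_elim
    case (elim \<omega>)
    have "\<forall>\<^sub>F n in sequentially. \<epsilon> * a * \<kappa> / 4 * real n powr g \<le> (\<Sum>i<n. \<psi> (norm (X i \<omega> - u) / h n))"
      using elim(1) eventually_gt_at_top[of 0]
    proof eventually_elim
      case (elim n)
      have "\<epsilon> * (a * \<kappa> / 4 * real n powr g) \<le> \<epsilon> * (\<Sum>i<n. indicator {x. (x - u) /\<^sub>R h n \<in> E} (X i \<omega>))"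
        using elim(1) \<epsilon> by (intro mult_left_mono) auto
      also have "\<dots> \<le> (\<Sum>i<n. \<psi> (norm (X i \<omega> - u) / h n))"
        unfolding sum_distrib_left
      proof (rule sum_mono)
        fix i
        show "\<epsilon> * indicator {x. (x - u) /\<^sub>R h n \<in> E} (X i \<omega>) \<le> \<psi> (norm (X i \<omega> - u) / h n)"
          using \<psi>_nonneg h_pos[OF elim(2)]
          by (auto simp: indicator_def E_def divide_inverse mult.commute)
      qed
      finally show ?case by (simp add: mult.assoc)
    qed
    moreover have "(\<Sum>i<2 ^ Suc j. indicator (cball u (h (2 ^ j))) (X i \<omega>))
        = real (card {i. i < 2 ^ Suc j \<and> norm (X i \<omega> - u) \<le> h (2 ^ j)})" for j
      by (simp add: indicator_def sum_of_bool_eq Int_def dist_norm norm_minus_commute del: power_Suc)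
    with elim(2) have "\<forall>\<^sub>F j in sequentially.
      real (card {i. i < 2 ^ Suc j \<and> norm (X i \<omega> - u) \<le> h (2 ^ j)}) \<le> 8 * b * V * (2 ^ j) powr g"
      by (auto elim!: eventually_mono)
    ultimately show ?case by blast
  qed
  moreover have "0 < \<epsilon> * a * \<kappa> / 4" "0 < 8 * b * V"
    using \<epsilon> a \<kappa> b V by auto
  ultimately show ?thesis by blast
qed

subsection \<open>Conditioning on the design\<close>

lemma (in prob_space) distr_pair_indep_rvs:
  assumes "indep_rvs M A Y B Z"
  shows "distr M A Y \<Otimes>\<^sub>M distr M B Z = distr M (A \<Otimes>\<^sub>M B) (\<lambda>\<omega>. (Y \<omega>, Z \<omega>))"
proof -
  have [measurable]: "Y \<in> measurable M A" "Z \<in> measurable M B"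
    and ind: "indep_set (sigma_sets (space M) {Y -` E \<inter> space M | E. E \<in> sets A})
       (sigma_sets (space M) {Z -` E \<inter> space M | E. E \<in> sets B})"
    using assms by (auto simp: indep_rvs_def)
  interpret Y: prob_space "distr M A Y" by (rule prob_space_distr) measurable
  interpret Z: prob_space "distr M B Z" by (rule prob_space_distr) measurable
  show ?thesis
  proof (rule pair_measure_eqI)
    fix E F assume "E \<in> sets (distr M A Y)" "F \<in> sets (distr M B Z)"
    then have [measurable]: "E \<in> sets A" "F \<in> sets B" by auto
    have "prob ((Y -` E \<inter> space M) \<inter> (Z -` F \<inter> space M)) = prob (Y -` E \<inter> space M) * prob (Z -` F \<inter> space M)"
      by (rule indep_setD[OF ind]) (auto intro!: sigma_sets.Basic)
    moreover have "(\<lambda>\<omega>. (Y \<omega>, Z \<omega>)) -` (E \<times> F) \<inter> space M = (Y -` E \<inter> space M) \<inter> (Z -` F \<inter> space M)"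
      by auto
    ultimately show "emeasure (distr M A Y) E * emeasure (distr M B Z) F
        = emeasure (distr M (A \<Otimes>\<^sub>M B) (\<lambda>\<omega>. (Y \<omega>, Z \<omega>))) (E \<times> F)"
      by (simp add: emeasure_distr emeasure_eq_measure ennreal_mult)
  qed (auto intro: Y.sigma_finite_measure_axioms Z.sigma_finite_measure_axioms)
qed

text \<open>The joint law is the product of the two laws, so the measure of the exceptional set is
  the integral of the measures of its sections. It therefore suffices to freeze \<open>Y\<close> and
  let \<open>Z\<close> run over a separate copy \<open>\<omega>'\<close> of the sample
  space.\<close>

lemma (in prob_space) indep_rvs_AE:
  assumes ind: "indep_rvs M A Y B Z"
    and P[measurable]: "Measurable.pred (A \<Otimes>\<^sub>M B) (\<lambda>z. P (fst z) (snd z))"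
    and AE: "AE \<omega> in M. AE \<omega>' in M. P (Y \<omega>) (Z \<omega>')"
  shows "AE \<omega> in M. P (Y \<omega>) (Z \<omega>)"
proof -
  have [measurable]: "Y \<in> measurable M A" "Z \<in> measurable M B"
    using ind by (auto simp: indep_rvs_def)
  interpret Z: prob_space "distr M B Z" by (rule prob_space_distr) measurable
  define N where "N = {z \<in> space (A \<Otimes>\<^sub>M B). \<not> P (fst z) (snd z)}"
  have N[measurable]: "N \<in> sets (A \<Otimes>\<^sub>M B)" unfolding N_def by measurable
  have Nd: "N \<in> sets (distr M A Y \<Otimes>\<^sub>M distr M B Z)"
    using N by (simp cong: sets_pair_measure_cong)
  have "emeasure (distr M (A \<Otimes>\<^sub>M B) (\<lambda>\<omega>. (Y \<omega>, Z \<omega>))) N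
    = (\<integral>\<^sup>+y. emeasure (distr M B Z) (Pair y -` N) \<partial>distr M A Y)"
    unfolding distr_pair_indep_rvs[OF ind, symmetric] by (rule Z.emeasure_pair_measure_alt[OF Nd])
  also have "\<dots> = (\<integral>\<^sup>+\<omega>. emeasure (distr M B Z) (Pair (Y \<omega>) -` N) \<partial>M)"
    using Z.measurable_emeasure_Pair[OF Nd] by (intro nn_integral_distr) auto
  also have "\<dots> = (\<integral>\<^sup>+\<omega>. 0 \<partial>M)"
  proof (rule nn_integral_cong_AE)
    show "AE \<omega> in M. emeasure (distr M B Z) (Pair (Y \<omega>) -` N) = 0"
      using AE AE_space
    proof eventually_elim
      case (elim \<omega>)
      have "Y \<omega> \<in> space A" using elim(2) by (rule measurable_space[rotated]) measurable
      have "emeasure (distr M B Z) (Pair (Y \<omega>) -` N) = emeasure M (Z -` (Pair (Y \<omega>) -` N) \<inter> space M)"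
        by (rule emeasure_distr) (auto intro: sets_Pair1[OF N])
      also have "\<dots> = 0"
      proof -
        have "Z -` (Pair (Y \<omega>) -` N) \<inter> space M \<in> sets M"
          by (intro measurable_sets[of Z M B] sets_Pair1[OF N]) measurable
        moreover have "AE \<omega>' in M. \<omega>' \<notin> Z -` (Pair (Y \<omega>) -` N) \<inter> space M"
          using elim(1) by (auto simp: N_def elim!: eventually_mono)
        ultimately show ?thesis by (intro null_setsD1) (rule AE_iff_null_sets[THEN iffD2])
      qed
      finally show ?case .
    qed
  qed
  finally have "emeasure (distr M (A \<Otimes>\<^sub>M B) (\<lambda>\<omega>. (Y \<omega>, Z \<omega>))) N = 0" by simp
  moreover have "emeasure (distr M (A \<Otimes>\<^sub>M B) (\<lambda>\<omega>. (Y \<omega>, Z \<omega>))) N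
      = emeasure M ((\<lambda>\<omega>. (Y \<omega>, Z \<omega>)) -` N \<inter> space M)"
    by (rule emeasure_distr[OF _ N]) measurable
  moreover have eq: "(\<lambda>\<omega>. (Y \<omega>, Z \<omega>)) -` N \<inter> space M = {\<omega> \<in> space M. \<not> P (Y \<omega>) (Z \<omega>)}"
    using measurable_space[of Y M A] measurable_space[of Z M B] by (auto simp: N_def space_pair_measure)
  ultimately have "emeasure M {\<omega> \<in> space M. \<not> P (Y \<omega>) (Z \<omega>)} = 0" by simp
  moreover have "{\<omega> \<in> space M. \<not> P (Y \<omega>) (Z \<omega>)} \<in> sets M"
    unfolding eq[symmetric] by (rule measurable_sets[OF _ N]) measurable
  ultimately show ?thesis
    by (subst AE_iff_measurable[OF _ refl]) auto
qed

section \<open>Passing from a Lebesgue measurable kernel to a Borel version of it\<close>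

lemma AE_lborel_scaled_norm:
  fixes u :: "'a::euclidean_space"
  assumes "AE t in lborel. P t" "0 < h"
  shows "AE x in lborel. P (norm (x - u) / h)"
proof -
  from AE_lborel_norm[OF assms(1)]
  obtain N where N: "{x \<in> space lborel. \<not> P (norm (x :: 'a))} \<subseteq> N"
    "emeasure lborel N = 0" "N \<in> sets lborel"
    by (rule AE_E)
  then have "emeasure lborel {x. (x - u) /\<^sub>R h \<in> N} = 0"
    using assms(2) by (subst emeasure_lborel_vimage_scale) auto
  moreover have "{x. (x - u) /\<^sub>R h \<in> N} \<in> sets lborel"
    using N(3) by measurable
  ultimately show ?thesis
  proof (intro AE_I)
    show "{x \<in> space lborel. \<not> P (norm (x - u) / h)} \<subseteq> {x. (x - u) /\<^sub>R h \<in> N}"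
      using N(1) assms(2) by (force simp: divide_inverse mult.commute)
  qed auto
qed

lemma distributed_AE_lborel:
  assumes X: "distributed M lborel X g" and "AE x in lborel. P x"
  shows "AE \<omega> in M. P (X \<omega>)"
proof -
  have [measurable]: "X \<in> measurable M lborel" "g \<in> borel_measurable lborel"
    using X by (auto simp: distributed_def)
  have "AE x in distr M lborel X. P x"
    unfolding distributed_distr_eq_density[OF X] using assms(2)
    by (subst AE_density) (auto elim: eventually_mono)
  then show ?thesis by (rule AE_distrD[rotated]) measurable
qed

text \<open>A Borel representative of \<open>\<phi>\<close> makes its compositions with random
  distances measurable. Clipping it to \<open>{0..B}\<close> and to \<open>\<bar>t\<bar> < 1\<close>
  restores bounds and support everywhere, whereas positivity near 0 is inherited almost everywhere
  only.\<close>

lemma kernel_function_borel_version: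
  assumes "kernel_function \<phi>" "\<phi> \<in> borel_measurable lebesgue"
  obtains \<psi> B \<eta> where "\<psi> \<in> borel_measurable borel" "AE t in lborel. \<psi> t = \<phi> t"
    "\<And>t. 0 \<le> \<psi> t" "\<And>t. \<psi> t \<le> B" "\<And>t. 1 \<le> \<bar>t\<bar> \<Longrightarrow> \<psi> t = 0"
    "AE t in lborel. \<bar>t\<bar> \<le> \<eta> \<longrightarrow> 0 < \<psi> t" "0 < \<eta>"
proof -
  obtain \<eta> where \<eta>: "0 < \<eta>" "\<And>t. \<bar>t\<bar> \<le> \<eta> \<Longrightarrow> 0 < \<phi> t" "\<And>t. 1 \<le> \<bar>t\<bar> \<Longrightarrow> \<phi> t = 0"
    and \<phi>: "\<And>t. 0 \<le> \<phi> t" "bounded (range \<phi>)"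
    using assms(1) unfolding kernel_function_def by auto
  obtain B where B: "0 < B" "\<And>t. \<phi> t \<le> B"
    using \<phi>(2) unfolding bounded_pos by (metis abs_le_D1 rangeI real_norm_def)
  obtain r where [measurable]: "r \<in> borel_measurable lborel" and r: "AE t in lborel. \<phi> t = r t"
    using completion_ex_borel_measurable_real[OF assms(2)] by blast
  define \<psi> where "\<psi> t = (if \<bar>t\<bar> < 1 then max 0 (min B (r t)) else 0)" for t
  have eq: "AE t in lborel. \<psi> t = \<phi> t"
    using r
  proof eventually_elim
    case (elim t)
    then show ?case using B(2)[of t] \<phi>(1)[of t] \<eta>(3)[of t] by (auto simp: \<psi>_def)
  qed
  show thesis
  proof (rule that[of \<psi> B \<eta>])
    show "\<psi> \<in> borel_measurable borel" unfolding \<psi>_def[abs_def] by measurable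
    show "AE t in lborel. \<bar>t\<bar> \<le> \<eta> \<longrightarrow> 0 < \<psi> t"
      using eq by eventually_elim (use \<eta>(2) in auto)
  qed (use eq B \<eta> in \<open>auto simp: \<psi>_def\<close>)
qed

text \<open>The diagonal entries are squared coordinates, so integrability of the outer product
  provides the coordinatewise second moments.\<close>

lemma columnvector_outer_nth: "(columnvector v ** transpose (columnvector v :: real ^ 1 ^ 'q::finite)) $ i $ j = v $ i * v $ j"
  by (simp add: columnvector_def matrix_matrix_mult_def transpose_def)

text \<open>With the design frozen, the weights are deterministic and each coordinate of the noise
  is a scalar i.i.d. sequence, so the weighted averages converge for almost every noise.
  Independence of design and noise then joins the two.\<close>

lemma (in prob_space) kernel_weighted_noise_AE:
  fixes X :: "nat \<Rightarrow> 'a \<Rightarrow> 'b::euclidean_space" and W :: "nat \<Rightarrow> 'a \<Rightarrow> real ^ 'q::finite"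
    and h :: "nat \<Rightarrow> real"
  assumes W: "indep_vars (\<lambda>_. borel) W UNIV" "\<And>i. distr M borel (W i) = distr M borel (W 0)"
      "has_bochner_integral M (W 0) 0"
      "integrable M (\<lambda>\<omega>. columnvector (W 0 \<omega>) ** transpose (columnvector (W 0 \<omega>) :: real ^ 1 ^ 'q))"
    and XW: "indep_rvs M (Pi\<^sub>M UNIV (\<lambda>_. borel)) (\<lambda>\<omega> i. X i \<omega>) (Pi\<^sub>M UNIV (\<lambda>_. borel)) (\<lambda>\<omega> i. W i \<omega>)"
    and \<psi>[measurable]: "\<psi> \<in> borel_measurable borel"
    and \<psi>_bd: "\<And>t. 0 \<le> \<psi> t" "\<And>t. \<psi> t \<le> B" "\<And>t. 1 \<le> \<bar>t\<bar> \<Longrightarrow> \<psi> t = 0"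
    and h: "\<And>n. 0 < n \<Longrightarrow> 0 < h n" "\<And>m n. 0 < m \<Longrightarrow> m \<le> n \<Longrightarrow> h n \<le> h m"
    and pos: "0 < c" "0 < C" "0 < g"
    and design: "AE \<omega> in M.
      (\<forall>\<^sub>F n in sequentially. c * real n powr g \<le> (\<Sum>i<n. \<psi> (norm (X i \<omega> - u) / h n))) \<and>
      (\<forall>\<^sub>F j in sequentially.
        real (card {i. i < 2 ^ Suc j \<and> norm (X i \<omega> - u) \<le> h (2 ^ j)}) \<le> C * (2 ^ j) powr g)"
  shows "AE \<omega> in M. (\<lambda>n. (\<Sum>i<n. \<psi> (norm (X i \<omega> - u) / h n) *\<^sub>R W i \<omega>)
      /\<^sub>R (\<Sum>i<n. \<psi> (norm (X i \<omega> - u) / h n))) \<longlonglongrightarrow> 0"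
proof -
  have [measurable]: "random_variable borel (W i)" for i
    using W(1) by (auto simp: indep_vars_def)
  have "AE \<omega> in M. \<forall>r::'q. (\<lambda>n. (\<Sum>i<n. \<psi> (norm (X i \<omega> - u) / h n) * (W i \<omega> $ r))
      / (\<Sum>i<n. \<psi> (norm (X i \<omega> - u) / h n))) \<longlonglongrightarrow> 0"
  proof (subst AE_all_countable, intro allI)
    fix r :: 'q
    show "AE \<omega> in M. (\<lambda>n. (\<Sum>i<n. \<psi> (norm (X i \<omega> - u) / h n) * (W i \<omega> $ r))
      / (\<Sum>i<n. \<psi> (norm (X i \<omega> - u) / h n))) \<longlonglongrightarrow> 0"
    proof (rule indep_rvs_AE[OF XW, where P = "\<lambda>x w. (\<lambda>n. (\<Sum>i<n. \<psi> (norm (x i - u) / h n) * (w i $ r))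
      / (\<Sum>i<n. \<psi> (norm (x i - u) / h n))) \<longlonglongrightarrow> 0"])
      let ?XW = "Pi\<^sub>M UNIV (\<lambda>_::nat. borel :: 'b measure) \<Otimes>\<^sub>M Pi\<^sub>M UNIV (\<lambda>_::nat. borel :: (real ^ 'q) measure)"
      have [measurable]: "(\<lambda>z. fst z i) \<in> borel_measurable ?XW" for i
        by (rule measurable_compose[OF measurable_fst measurable_component_singleton]) simp
      have snd_meas: "(\<lambda>z. snd z i) \<in> borel_measurable ?XW" for i
        by (rule measurable_compose[OF measurable_snd measurable_component_singleton]) simp
      have [measurable]: "(\<lambda>z. snd z i $ r) \<in> borel_measurable ?XW" for i
        by (rule measurable_compose[OF snd_meas borel_measurable_continuous_onI])
          (intro continuous_intros)
      have [measurable]: "(\<lambda>z. \<psi> (norm (fst z i - u) / h n)) \<in> borel_measurable ?XW" for i n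
        by (rule measurable_compose[OF _ \<psi>]) measurable
      have [measurable]: "(\<lambda>z. (\<Sum>i<n. \<psi> (norm (fst z i - u) / h n) * (snd z i $ r))
          / (\<Sum>i<n. \<psi> (norm (fst z i - u) / h n))) \<in> borel_measurable ?XW" for n
        by (intro borel_measurable_divide borel_measurable_sum borel_measurable_times) measurable
      show "Measurable.pred ?XW (\<lambda>z. (\<lambda>n. (\<Sum>i<n. \<psi> (norm (fst z i - u) / h n) * (snd z i $ r))
          / (\<Sum>i<n. \<psi> (norm (fst z i - u) / h n))) \<longlonglongrightarrow> 0)"
        unfolding tendsto_zero_iff_inverse_Suc by measurable
      show "AE \<omega> in M. AE \<omega>' in M. (\<lambda>n. (\<Sum>i<n. \<psi> (norm (X i \<omega> - u) / h n) * (W i \<omega>' $ r))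
          / (\<Sum>i<n. \<psi> (norm (X i \<omega> - u) / h n))) \<longlonglongrightarrow> 0"
        using design
      proof eventually_elim
        case (elim \<omega>)
        show ?case
        proof (rule weighted_average_AE[where c = c and C = C and g = g and J = "\<lambda>j. {i. i < 2 ^ Suc j \<and> norm (X i \<omega> - u) \<le> h (2 ^ j)}"])
          show "indep_vars (\<lambda>_. borel) (\<lambda>i \<omega>. W i \<omega> $ r) UNIV"
            by (rule indep_vars_compose2[OF W(1)]) simp
          have "distr M borel (\<lambda>\<omega>. W i \<omega> $ r) = distr (distr M borel (W i)) borel (\<lambda>v. v $ r)" for i
            by (subst distr_distr) (auto simp: comp_def)
          then show "distr M borel (\<lambda>\<omega>. W i \<omega> $ r) = distr M borel (\<lambda>\<omega>. W 0 \<omega> $ r)" for i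
            using W(2)[of i] by simp
          show "expectation (\<lambda>\<omega>. W 0 \<omega> $ r) = 0"
            using has_bochner_integral_bounded_linear[OF bounded_linear_vec_nth W(3), of r]
            by (simp add: has_bochner_integral_integral_eq)
          show "integrable M (\<lambda>\<omega>. (W 0 \<omega> $ r)\<^sup>2)"
            using integrable_bounded_linear[OF bounded_linear_vec_nth[of r]
                integrable_bounded_linear[OF bounded_linear_vec_nth[of r] W(4)]]
            by (simp add: columnvector_outer_nth power2_eq_square)
          \<comment> \<open>A nonzero weight at \<open>n\<close> forces distance at most
            \<open>h n\<close>, and \<open>h\<close> is decreasing, so the ball at the start of the
            block contains all balls of the block.\<close>
          fix n j i :: nat
          assume n: "2 ^ j \<le> n" "n < 2 ^ Suc j" "i < n" and nz: "\<psi> (norm (X i \<omega> - u) / h n) \<noteq> 0"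
          have "0 < n" using n(3) by simp
          from nz have "\<not> 1 \<le> \<bar>norm (X i \<omega> - u) / h n\<bar>" using \<psi>_bd(3) by blast
          then have "norm (X i \<omega> - u) \<le> h n" using h(1)[OF \<open>0 < n\<close>] by (simp add: field_simps)
          also have "\<dots> \<le> h (2 ^ j)" using n(1) by (intro h(2)) auto
          finally show "i \<in> {i. i < 2 ^ Suc j \<and> norm (X i \<omega> - u) \<le> h (2 ^ j)}"
            using n by simp
        qed (use \<psi>_bd pos elim in auto)
      qed
    qed
  qed
  then show ?thesis
  proof eventually_elim
    case (elim \<omega>)
    show ?case
    proof (rule vec_tendstoI)
      fix r
      show "(\<lambda>n. ((\<Sum>i<n. \<psi> (norm (X i \<omega> - u) / h n) *\<^sub>R W i \<omega>)
        /\<^sub>R (\<Sum>i<n. \<psi> (norm (X i \<omega> - u) / h n))) $ r) \<longlonglongrightarrow> 0 $ r"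
        using elim[rule_format, of r] by (simp add: divide_inverse mult.commute)
    qed
  qed
qed

text \<open>The exceptional set is contained in a null set and is measurable by completeness. This
  yields measurability of the set-limit event without analysing the set limits themselves.\<close>

lemma (in complete_measure) sets_Collect_AE:
  assumes "AE x in M. P x"
  shows "{x \<in> space M. P x} \<in> sets M"
proof -
  from assms obtain N where N: "{x \<in> space M. \<not> P x} \<subseteq> N" "emeasure M N = 0" "N \<in> sets M"
    by (rule AE_E)
  then have "{x \<in> space M. \<not> P x} \<in> sets M"
    by (intro complete[of _ N]) (auto simp: null_sets_def)
  moreover have "{x \<in> space M. P x} = space M - {x \<in> space M. \<not> P x}" by auto
  ultimately show ?thesis by auto
qed

section \<open>Assembly of design, noise and Hausdorff bound into the almost sure set limit\<close>

theorem theorem5: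
  fixes M :: "'w measure"
    and U :: "(real ^ 'd::finite) set"
    and S :: "real ^ 'd \<Rightarrow> (real ^ 'q::finite) set"
    and X :: "nat \<Rightarrow> 'w \<Rightarrow> real ^ 'd"
    and W :: "nat \<Rightarrow> 'w \<Rightarrow> real ^ 'q"
    and f :: "real ^ 'd \<Rightarrow> real"
    and \<phi> :: "real \<Rightarrow> real"
  assumes "prob_space M" and "complete_measure M"
    and "convex U" and "compact U"
    and "\<exists>\<kappa>. lipschitz_setfun \<kappa> U S"
    and "\<And>u. u \<in> U \<Longrightarrow> convex (S u) \<and> compact (S u)"
    and "prob_space.indep_vars M (\<lambda>_. borel) X UNIV"
    and "\<And>i \<omega>. \<omega> \<in> space M \<Longrightarrow> X i \<omega> \<in> U"
    and "\<And>i. distributed M lborel (X i) (\<lambda>x. ennreal (f x))"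
    and "\<And>x. 0 \<le> f x"
    and "\<exists>L. L-lipschitz_on U f"
    and "\<And>u. u \<in> U \<Longrightarrow> 0 < f u"
    and "prob_space.indep_vars M (\<lambda>_. borel) W UNIV"
    and "\<And>i. distr M borel (W i) = distr M borel (W 0)"
    and "\<And>i. has_bochner_integral M (W i) 0"
    and "\<And>i. integrable M
           (\<lambda>\<omega>. columnvector (W i \<omega>) ** transpose (columnvector (W i \<omega>) :: real ^ 1 ^ 'q))"
    and "indep_rvs M
           (Pi\<^sub>M UNIV (\<lambda>_. borel)) (\<lambda>\<omega> i. X i \<omega>)
           (Pi\<^sub>M UNIV (\<lambda>_. borel)) (\<lambda>\<omega> i. W i \<omega>)"
    and "kernel_function \<phi>"
    and "\<phi> \<in> borel_measurable lebesgue"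
    and "u \<in> U"
  shows "as_set_limit M
    (\<lambda>n \<omega>. kernel_set_estimator \<phi> (real n powr (- 1 / (real CARD('d) + 4))) n
             (\<lambda>i. X i \<omega>) (\<lambda>i. S (X i \<omega>) + {W i \<omega>}) u)
    (S u)"
proof -
  interpret prob_space M by fact
  interpret complete_measure M by fact
  have XU: "X i \<omega> \<in> U" if "\<omega> \<in> space M" for i \<omega> using assms(8) that by blast
  have X_dens: "distributed M lborel (X i) (\<lambda>x. ennreal (f x))" for i by fact
  obtain \<kappa> where S: "lipschitz_setfun \<kappa> U S" using assms(5) by blast
  have Su: "convex (S u)" "closed (S u)" using assms(6)[OF \<open>u \<in> U\<close>] by (auto simp: compact_imp_closed)
  have \<phi>: "\<And>t. 0 \<le> \<phi> t" "\<And>t. 1 \<le> \<bar>t\<bar> \<Longrightarrow> \<phi> t = 0"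
    using \<open>kernel_function \<phi>\<close> unfolding kernel_function_def by auto
  obtain \<psi> B \<eta> where \<psi>[measurable]: "\<psi> \<in> borel_measurable borel"
    and \<psi>_eq: "AE t in lborel. \<psi> t = \<phi> t"
    and \<psi>_bd: "\<And>t. 0 \<le> \<psi> t" "\<And>t. \<psi> t \<le> B" "\<And>t. 1 \<le> \<bar>t\<bar> \<Longrightarrow> \<psi> t = 0"
    and \<psi>_pos: "AE t in lborel. \<bar>t\<bar> \<le> \<eta> \<longrightarrow> 0 < \<psi> t" "0 < \<eta>"
    using kernel_function_borel_version[OF assms(18,19)] by blast
  define h where "h n = real n powr (- 1 / (real CARD('d) + 4))" for n
  define g where "g = 4 / (real CARD('d) + 4)"
  have g: "0 < g" by (simp add: g_def)
  have h_pos: "0 < h n" if "0 < n" for n using that by (simp add: h_def)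
  have h_mono: "h n \<le> h m" if "0 < m" "m \<le> n" for m n
    unfolding h_def using that by (intro powr_mono2') (auto simp: divide_nonpos_pos)
  have h_lim: "h \<longlonglongrightarrow> 0"
    unfolding h_def[abs_def]
    by (rule tendsto_neg_powr) (auto simp: filterlim_real_sequentially divide_neg_pos)
  have cont: "continuous_on U f" using assms(11) lipschitz_on_continuous_on by blast
  have "\<exists>c>0. \<exists>C>0. AE \<omega> in M.
    (\<forall>\<^sub>F n in sequentially. c * real n powr g \<le> (\<Sum>i<n. \<psi> (norm (X i \<omega> - u) / h n))) \<and>
    (\<forall>\<^sub>F j in sequentially.
      real (card {i. i < 2 ^ Suc j \<and> norm (X i \<omega> - u) \<le> h (2 ^ j)}) \<le> C * (2 ^ j) powr g)"
    by (rule kernel_design_AE[OF assms(7,3,4,20) XU X_dens cont assms(12) \<psi> \<psi>_bd(1) \<psi>_pos])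
      (simp_all add: h_def g_def)
  then obtain c C where c: "0 < c" "0 < C" and design: "AE \<omega> in M.
    (\<forall>\<^sub>F n in sequentially. c * real n powr g \<le> (\<Sum>i<n. \<psi> (norm (X i \<omega> - u) / h n))) \<and>
    (\<forall>\<^sub>F j in sequentially.
      real (card {i. i < 2 ^ Suc j \<and> norm (X i \<omega> - u) \<le> h (2 ^ j)}) \<le> C * (2 ^ j) powr g)"
    by blast
  have noise: "AE \<omega> in M. (\<lambda>n. (\<Sum>i<n. \<psi> (norm (X i \<omega> - u) / h n) *\<^sub>R W i \<omega>)
      /\<^sub>R (\<Sum>i<n. \<psi> (norm (X i \<omega> - u) / h n))) \<longlonglongrightarrow> 0"
    by (rule kernel_weighted_noise_AE[OF assms(13-17) \<psi> \<psi>_bd h_pos h_mono c g design])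
  \<comment> \<open>The law of \<open>X i\<close> has a density, so it does not charge the null set
    of points whose scaled distance is one where \<open>\<psi>\<close> and \<open>\<phi>\<close>
    differ; countably many pairs \<open>n\<close>, \<open>i\<close> are handled together. The case
    \<open>n = 0\<close> is left out because there the bandwidth is 0.\<close>
  have same: "AE \<omega> in M. \<forall>n i. 0 < n \<longrightarrow>
      \<psi> (norm (X i \<omega> - u) / h n) = \<phi> (norm (X i \<omega> - u) / h n)"
    unfolding AE_all_countable
  proof (intro allI)
    fix n i :: nat
    show "AE \<omega> in M. 0 < n \<longrightarrow> \<psi> (norm (X i \<omega> - u) / h n) = \<phi> (norm (X i \<omega> - u) / h n)"
    proof (cases "0 < n")
      case True
      have "AE \<omega> in M. \<psi> (norm (X i \<omega> - u) / h n) = \<phi> (norm (X i \<omega> - u) / h n)"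
        by (rule distributed_AE_lborel[OF X_dens[of i] AE_lborel_scaled_norm[OF \<psi>_eq h_pos[OF True]]])
      then show ?thesis by simp
    qed simp
  qed
  have "AE \<omega> in M. has_set_limit (\<lambda>n. kernel_set_estimator \<phi> (h n) n
      (\<lambda>i. X i \<omega>) (\<lambda>i. S (X i \<omega>) + {W i \<omega>}) u) (S u)"
    using design noise same AE_space
  proof eventually_elim
    case (elim \<omega>)
    define D where "D n = (\<Sum>i<n. \<psi> (norm (X i \<omega> - u) / h n))" for n
    define e where "e n = \<kappa> * h n + norm ((\<Sum>i<n. \<psi> (norm (X i \<omega> - u) / h n) *\<^sub>R W i \<omega>) /\<^sub>R D n)" for n
    note XU' = XU[OF elim(4)]
    \<comment> \<open>The lower design bound makes the normaliser eventually positive, so the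
      degenerate value \<open>{0}\<close> of the estimator can occur only finitely often.\<close>
    have D: "\<forall>\<^sub>F n in sequentially. 0 < n \<and> 0 < D n"
      using elim(1)[THEN conjunct1] eventually_gt_at_top[of 0]
    proof eventually_elim
      case (elim n)
      have "0 < c * real n powr g" using elim(2) c by simp
      with elim show ?case by (simp add: D_def)
    qed
    have close: "(\<forall>y\<in>kernel_set_estimator \<phi> (h n) n (\<lambda>i. X i \<omega>) (\<lambda>i. S (X i \<omega>) + {W i \<omega>}) u.
          \<exists>s\<in>S u. dist y s \<le> e n) \<and>
        (\<forall>s\<in>S u. \<exists>y\<in>kernel_set_estimator \<phi> (h n) n (\<lambda>i. X i \<omega>) (\<lambda>i. S (X i \<omega>) + {W i \<omega>}) u.
          dist y s \<le> e n)"
      if n: "0 < n" "0 < D n" for n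
    proof -
      have eq: "\<psi> (norm (X i \<omega> - u) / h n) = \<phi> (norm (X i \<omega> - u) / h n)" for i
        using elim(3) n(1) by blast
      have pos: "0 < (\<Sum>i<n. \<phi> (norm (X i \<omega> - u) / h n))" using n(2) by (simp add: D_def eq)
      show ?thesis
        unfolding e_def D_def eq
        by (intro conjI; rule kernel_set_estimator_dist[OF h_pos[OF n(1)] n(1) \<phi> S Su(1) \<open>u \<in> U\<close> XU' pos])
    qed
    show ?case
    proof (rule has_set_limitI[where e = e])
      show "closed (S u)" by fact
      show "kernel_set_estimator \<phi> (h n) n (\<lambda>i. X i \<omega>) (\<lambda>i. S (X i \<omega>) + {W i \<omega>}) u \<noteq> {}" for n
      proof (rule kernel_set_estimator_nonempty)
        fix i
        have "S (X i \<omega>) \<noteq> {}" using S XU' by (auto simp: lipschitz_setfun_def)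
        then show "S (X i \<omega>) + {W i \<omega>} \<noteq> {}" by (blast intro: set_plus_intro)
      qed
      \<comment> \<open>The bias bound vanishes with the bandwidth, and the noise average vanishes
        for this \<open>\<omega>\<close>.\<close>
      have "e \<longlonglongrightarrow> \<kappa> * 0 + 0"
        unfolding e_def[abs_def] D_def
        by (intro tendsto_add tendsto_mult tendsto_const h_lim tendsto_norm_zero elim(2))
      then show "e \<longlonglongrightarrow> 0" by simp
    qed (rule eventually_mono[OF D], use close in blast)+
  qed
  then show ?thesis
    unfolding as_set_limit_def h_def by (subst prob_Collect_eq_1) (auto intro: sets_Collect_AE)
qed

end
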